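(* Let $X$ be a real hyperelliptic curve of genus $g\ge 1$ with $n(X)\ge 1$ real connected components, given by the affine equation $$y^2=f(x)=x\prod_{i=1}^{2n(X)-2}(x-p_i)\prod_{j=1}^{g+1-n(X)}(x-q_j)(x-\overline{q_j}),$$ where the $p_i\in\mathbb{R}^*$ and $q_j\in\mathbb{C}\setminus\mathbb{R}$ are such that all roots $0,p_i,q_j,\overline{q_j}$ of $f$ are distinct, and let $k\ge g$. Write $\mathrm{Inf}(|\mathcal{L}_{\mathbb{R}}(kD)|)=R+S$, where $R$ and $S$ are effective, $R$ is supported on the ramification locus of $\pi$, and the support of $S$ is disjoint from the ramification locus of $\pi$. Then $$R=\binom{g+1}{2}R_\pi,$$ where $R_\pi$ denotes the ramification divisor of $\pi$.
   Context: $X$ denotes the smooth projective complex curve compactifying the affine curve $y^2=f(x)$ by one point $\infty$, with the antiholomorphic involution $\sigma_X$ extending $(x,y)\mapsto(\overline{x},\overline{y})$. $n(X)$ is the number of connected components of the fixed locus $X(\mathbb{R})$ of $\sigma_X$. The hyperelliptic structure map is $\pi:X\to\mathbb{P}^1$, $(x,y)\mapsto x$, and $D=2\cdot\infty=\pi^*(\infty)$. $\mathcal{L}_{\mathbb{R}}(kD)$ is the real line bundle defined by $kD$ and $|\mathcal{L}_{\mathbb{R}}(kD)|$ is the complete real linear series given by the space of all real sections $H^0(X_{\mathbb{R}},\mathcal{L}_{\mathbb{R}}(kD))$. For a linear series with section space $V$ of dimension $r+1$ and a point $p\in X$, let $o_0<\dots<o_r$ be the vanishing orders at $p$ of the nonzero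 sections in (the complexification of) $V$. The inflectionary weight is $|p|=\sum_{i=0}^r(o_i-i)$, and the inflection divisor is $\mathrm{Inf}=\sum_{p}|p|\cdot p$. *)

theory Defs
  imports "HOL-Complex_Analysis.Complex_Analysis" "HOL-Library.Function_Algebras"
begin

section \<open>The compactified curve and its real structure\<close>

text \<open>\<^term>\<open>Some (x, y)\<close> is the affine point \<open>(x, y)\<close>; \<^term>\<open>None\<close> is the point at infinity.\<close>

type_synonym point = "(complex \<times> complex) option"

definition affine_curve :: "complex poly \<Rightarrow> (complex \<times> complex) set" where
  "affine_curve f = {(x, y). y\<^sup>2 = poly f x}"

definition curve :: "complex poly \<Rightarrow> point topology" where
  "curve f = Alexandroff_compactification (top_of_set (affine_curve f))"

definition conj_point :: "point \<Rightarrow> point" where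
  "conj_point = map_option (map_prod cnj cnj)"

definition real_locus :: "complex poly \<Rightarrow> point set" where
  "real_locus f = {P \<in> topspace (curve f). conj_point P = P}"

definition num_real_components :: "complex poly \<Rightarrow> nat" where
  "num_real_components f = card (connected_components_of (subtopology (curve f) (real_locus f)))"


section \<open>The complex structure\<close>

definition xcoord :: "point \<Rightarrow> complex" where
  "xcoord P = fst (the P)"

definition ycoord :: "point \<Rightarrow> complex" where
  "ycoord P = snd (the P)"

text \<open>
  The complex structure of the curve is the one in which \<open>x\<close> and \<open>y\<close> are holomorphic on the
  affine part, extended over infinity. If \<open>f\<close> has odd degree and only simple roots, so that the
  affine curve is smooth with a single end, then a map from a disc into the curve is
  holomorphic iff it is continuous and its affine coordinates are holomorphic where it avoids
  infinity (a continuous map is automatically holomorphic at an isolated preimage of infinity). An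
  injective holomorphic map from a disc is biholomorphic onto an open neighbourhood of the image of
  the centre, i.e. the inverse of a chart.
\<close>

definition local_parametrisation :: "complex poly \<Rightarrow> point \<Rightarrow> (complex \<Rightarrow> point) \<Rightarrow> bool" where
  "local_parametrisation f P \<gamma> \<longleftrightarrow> \<gamma> 0 = P \<and>
     (\<exists>r>0. inj_on \<gamma> (ball 0 r) \<and>
        continuous_map (top_of_set (ball 0 r)) (curve f) \<gamma> \<and>
        (\<lambda>z. xcoord (\<gamma> z)) holomorphic_on {z \<in> ball 0 r. \<gamma> z \<noteq> None} \<and>
        (\<lambda>z. ycoord (\<gamma> z)) holomorphic_on {z \<in> ball 0 r. \<gamma> z \<noteq> None})"

text \<open>The notions defined through this choice do not depend on it, since two local
  parametrisations at a point differ by a biholomorphic change of variable fixing 0.\<close>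

definition parametrisation_at :: "complex poly \<Rightarrow> point \<Rightarrow> complex \<Rightarrow> point" where
  "parametrisation_at f P = (SOME \<gamma>. local_parametrisation f P \<gamma>)"

definition holomorphic_at :: "complex poly \<Rightarrow> (point \<Rightarrow> complex) \<Rightarrow> point \<Rightarrow> bool" where
  "holomorphic_at f h P \<longleftrightarrow> (h \<circ> parametrisation_at f P) analytic_on {0}"

definition meromorphic_at :: "complex poly \<Rightarrow> (point \<Rightarrow> complex) \<Rightarrow> point \<Rightarrow> bool" where
  "meromorphic_at f h P \<longleftrightarrow> (h \<circ> parametrisation_at f P) meromorphic_on {0}"

text \<open>Like \<^const>\<open>zorder\<close>, this depends only on the values of \<open>h\<close> near \<open>P\<close> but not at \<open>P\<close>. It is
  meaningful if \<open>h\<close> is meromorphic at \<open>P\<close> and not identically zero near \<open>P\<close>.\<close>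

definition ord_at :: "complex poly \<Rightarrow> (point \<Rightarrow> complex) \<Rightarrow> point \<Rightarrow> int" where
  "ord_at f h P = zorder (h \<circ> parametrisation_at f P) 0"


section \<open>Divisors\<close>

type_synonym divisor = "point \<Rightarrow> int"

definition divisor_support :: "divisor \<Rightarrow> point set" where
  "divisor_support E = {P. E P \<noteq> 0}"

definition effective_divisor :: "complex poly \<Rightarrow> divisor \<Rightarrow> bool" where
  "effective_divisor f E \<longleftrightarrow>
     finite (divisor_support E) \<and> divisor_support E \<subseteq> topspace (curve f) \<and> (\<forall>P. E P \<ge> 0)"

definition twice_infinity :: divisor where
  "twice_infinity P = (if P = None then 2 else 0)"


section \<open>The hyperelliptic map and its ramification\<close>

text \<open>Local multiplicity of \<open>\<pi>(x, y) = x\<close>: the vanishing order at \<open>P\<close> of \<open>\<pi>\<close> in a coordinate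
  of the projective line centred at \<open>\<pi>(P)\<close>, namely \<open>x - x(P)\<close> at an affine point and \<open>1 / x\<close> at
  infinity.\<close>

definition ramification_index :: "complex poly \<Rightarrow> point \<Rightarrow> int" where
  "ramification_index f P = (case P of
       Some (a, b) \<Rightarrow> ord_at f (\<lambda>Q. xcoord Q - a) P
     | None \<Rightarrow> ord_at f (\<lambda>Q. 1 / xcoord Q) P)"

definition ramification_divisor :: "complex poly \<Rightarrow> divisor" where
  "ramification_divisor f P = (if P \<in> topspace (curve f) then ramification_index f P - 1 else 0)"

definition ramification_locus :: "complex poly \<Rightarrow> point set" where
  "ramification_locus f = {P \<in> topspace (curve f). ramification_index f P > 1}"


section \<open>Real linear series and inflection\<close>

text \<open>
  A global section of \<open>\<L>(E)\<close> is a meromorphic function \<open>h\<close> on the curve with \<open>div h + E \<ge> 0\<close>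
  (or \<open>h = 0\<close>). It is represented by its restriction to the complement of the support of \<open>E\<close>,
  extended by 0: this determines the section, and addition of sections is pointwise addition,
  also when poles cancel.
\<close>

definition section_order :: "complex poly \<Rightarrow> divisor \<Rightarrow> (point \<Rightarrow> complex) \<Rightarrow> point \<Rightarrow> int" where
  "section_order f E h P = ord_at f h P + E P"

definition global_sections :: "complex poly \<Rightarrow> divisor \<Rightarrow> (point \<Rightarrow> complex) set" where
  "global_sections f E = {h.
     (\<forall>P. P \<notin> topspace (curve f) \<or> E P \<noteq> 0 \<longrightarrow> h P = 0) \<and>
     (\<forall>P \<in> topspace (curve f). E P = 0 \<longrightarrow> holomorphic_at f h P) \<and>
     (\<forall>P \<in> topspace (curve f). E P \<noteq> 0 \<longrightarrow> meromorphic_at f h P) \<and>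
     (h \<noteq> (\<lambda>_. 0) \<longrightarrow> (\<forall>P \<in> topspace (curve f). section_order f E h P \<ge> 0))}"

text \<open>For \<open>f\<close> with real coefficients and \<open>E\<close> invariant under conjugation, the real structure on
  \<open>\<L>(E)\<close> sends \<open>h\<close> to the conjugate of \<open>h \<circ> \<sigma>\<close>.\<close>

definition real_sections :: "complex poly \<Rightarrow> divisor \<Rightarrow> (point \<Rightarrow> complex) set" where
  "real_sections f E =
     {h \<in> global_sections f E. \<forall>P \<in> topspace (curve f). h (conj_point P) = cnj (h P)}"

definition complexification :: "(point \<Rightarrow> complex) set \<Rightarrow> (point \<Rightarrow> complex) set" where
  "complexification V = {(\<lambda>P. s P + \<i> * t P) |s t. s \<in> V \<and> t \<in> V}"

definition real_dim :: "(point \<Rightarrow> complex) set \<Rightarrow> nat" where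
  "real_dim V = vector_space.dim (\<lambda>(c::real) (h::point \<Rightarrow> complex) P. c *\<^sub>R h P) V"

definition vanishing_orders ::
  "complex poly \<Rightarrow> divisor \<Rightarrow> (point \<Rightarrow> complex) set \<Rightarrow> point \<Rightarrow> int set" where
  "vanishing_orders f E V P =
     {section_order f E s P |s. s \<in> complexification V \<and> s \<noteq> (\<lambda>_. 0)}"

text \<open>The set of vanishing orders has exactly \<^term>\<open>real_dim V\<close> elements, listed increasingly
  as \<open>o\<^sub>0 < \<dots> < o\<^sub>r\<close>.\<close>

definition inflectionary_weight ::
  "complex poly \<Rightarrow> divisor \<Rightarrow> (point \<Rightarrow> complex) set \<Rightarrow> point \<Rightarrow> int" where
  "inflectionary_weight f E V P =
     (\<Sum>i<real_dim V. sorted_list_of_set (vanishing_orders f E V P) ! i - int i)"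

definition inflection_divisor ::
  "complex poly \<Rightarrow> divisor \<Rightarrow> (point \<Rightarrow> complex) set \<Rightarrow> divisor" where
  "inflection_divisor f E V P =
     (if P \<in> topspace (curve f) then inflectionary_weight f E V P else 0)"

definition complete_real_inflection :: "complex poly \<Rightarrow> divisor \<Rightarrow> divisor" where
  "complete_real_inflection f E = inflection_divisor f E (real_sections f E)"

end

theory Submission
  imports Defs "HOL-Computational_Algebra.Fundamental_Theorem_Algebra"
begin

text \<open>
  The weight of a linear series at a point depends only on the set of vanishing orders there. For
  \<open>k \<ge> g\<close> the sections of \<open>\<L>(kD)\<close> are the functions \<open>A(x) + B(x) y\<close> with polynomials \<open>A\<close> of
  degree at most \<open>k\<close> and \<open>B\<close> of degree less than \<open>k - g\<close>. At a ramification point a local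
  coordinate can be chosen in which the hyperelliptic involution is \<open>t \<mapsto> -t\<close>, so that \<open>A(x)\<close> has
  even order, \<open>B(x) y\<close> has odd order, and the order of the sum is the smaller of the two. At a
  point \<open>(a, 0)\<close> the orders of \<open>(x - a)^i\<close> and \<open>(x - a)^j y\<close> are \<open>2 i\<close> and \<open>2 j + 1\<close>; at infinity
  the powers of \<open>x\<close> give the same list in reverse. Hence at each ramification point the vanishing
  orders are the even numbers up to \<open>2 k\<close> together with the odd numbers below \<open>2 (k - g)\<close>. With
  \<open>m = k - g\<close>, subtracting \<open>0 + 1 + \<dots> + (2 m + g)\<close> from their sum
  \<open>(m + g) (m + g + 1) + m\<^sup>2\<close> leaves \<open>g (g + 1) / 2\<close>, whatever \<open>k\<close> is. As the ramification is
  simple, this is the asserted multiple of the ramification divisor.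

  Two facts carry the argument. The first is that orders and holomorphy can be read off in explicit
  coordinates although they are defined through an unspecified parametrisation
  (\<open>parametrisation_transfer\<close>): near a point \<open>P\<close> there is a function \<open>w\<close> on the curve (namely \<open>y\<close>,
  \<open>x - a\<close> or \<open>x^g / y\<close>) with an explicit inverse, so every parametrisation \<open>\<gamma>\<close> at \<open>P\<close> makes
  \<open>w \<circ> \<gamma>\<close> injective, hence a biholomorphic change of variable. All orders follow from the
  equation \<open>y\<^sup>2 = f(x)\<close> and the fact that \<open>w\<close> has order 1.

  The second is the determination of the space of sections. For a function \<open>h\<close> holomorphic on the
  affine curve and meromorphic at infinity, the trace \<open>h(x, y) + h(x, -y)\<close> is an entire function of
  \<open>x\<close> of polynomial growth, hence a polynomial (\<open>trace_polynomial\<close>). Applied to \<open>h\<close> and to \<open>h y\<close>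
  this yields \<open>h = A(x) + B(x) y\<close>, and the order at infinity bounds the degrees
  (\<open>global_sections_eq\<close>). Sections invariant under conjugation are those with real
  coefficients, so the complexified real series is the whole complex series.
\<close>

section \<open>Order of a function at the origin\<close>

text \<open>\<^const>\<open>zorder\<close> is meaningful only for meromorphic functions that do not vanish identically
  near the point. Bundling these conditions with the value makes the arithmetic of orders
  compositional.\<close>

definition has_order :: "(complex \<Rightarrow> complex) \<Rightarrow> int \<Rightarrow> bool" where
  "has_order u m \<longleftrightarrow> u meromorphic_on {0} \<and> (\<forall>\<^sub>F z in at 0. u z \<noteq> 0) \<and> zorder u 0 = m"

lemma has_orderD:
  assumes "has_order u m"
  shows "u meromorphic_on {0}" "\<forall>\<^sub>F z in at 0. u z \<noteq> 0" "\<exists>\<^sub>F z in at 0. u z \<noteq> 0"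
    "zorder u 0 = m"
  using assms by (auto simp: has_order_def intro!: eventually_frequently)

lemma has_orderI:
  assumes "u meromorphic_on {0}" "\<exists>\<^sub>F z in at 0. u z \<noteq> 0" "zorder u 0 = m"
  shows "has_order u m"
proof -
  have "\<forall>\<^sub>F z in at 0. u z \<noteq> 0"
  proof -
    obtain U where U: "u has_laurent_expansion U"
      using assms(1) by (auto simp: meromorphic_on_def)
    show ?thesis
      using has_laurent_expansion_frequently_nonzero_iff[of u 0 U]
        has_laurent_expansion_eventually_nonzero_iff[of u 0 U] U assms(2) by simp
  qed
  then show ?thesis using assms by (simp add: has_order_def)
qed

lemma has_order_cong:
  assumes "\<forall>\<^sub>F z in at 0. u z = v z"
  shows "has_order u m \<longleftrightarrow> has_order v m"
proof -
  have "u meromorphic_on {0} \<longleftrightarrow> v meromorphic_on {0}"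
    using assms by (intro meromorphic_on_cong) auto
  moreover have "(\<forall>\<^sub>F z in at 0. u z \<noteq> 0) \<longleftrightarrow> (\<forall>\<^sub>F z in at 0. v z \<noteq> 0)"
    by (rule eventually_cong[OF assms]) auto
  moreover have "zorder u 0 = zorder v 0"
    using assms by (intro zorder_cong) auto
  ultimately show ?thesis by (simp add: has_order_def)
qed

lemma has_order_mult:
  assumes "has_order u m" "has_order v n"
  shows "has_order (\<lambda>z. u z * v z) (m + n)"
proof -
  note u = has_orderD[OF assms(1)] and v = has_orderD[OF assms(2)]
  have "\<forall>\<^sub>F z in at 0. u z * v z \<noteq> 0"
    using u(2) v(2) by eventually_elim simp
  then show ?thesis
    unfolding has_order_def using u v by (auto intro!: meromorphic_intros zorder_mult)
qed

lemma has_order_divide: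
  assumes "has_order u m" "has_order v n"
  shows "has_order (\<lambda>z. u z / v z) (m - n)"
proof -
  note u = has_orderD[OF assms(1)] and v = has_orderD[OF assms(2)]
  have "\<forall>\<^sub>F z in at 0. u z / v z \<noteq> 0"
    using u(2) v(2) by eventually_elim simp
  then show ?thesis
    unfolding has_order_def using u v by (auto intro!: meromorphic_intros zorder_divide)
qed

lemma has_order_power:
  assumes "has_order u m"
  shows "has_order (\<lambda>z. u z ^ n) (int n * m)"
proof -
  note u = has_orderD[OF assms]
  have "\<forall>\<^sub>F z in at 0. u z ^ n \<noteq> 0"
    using u(2) by eventually_elim simp
  then show ?thesis
    unfolding has_order_def using u zorder_power[of u 0 n] by (auto intro!: meromorphic_intros)
qed

text \<open>Unlike for general sums, no cancellation of leading terms is possible when the orders differ;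
  this is what makes the parity argument work.\<close>

lemma has_order_add:
  assumes "has_order u m" "has_order v n" "m \<noteq> n"
  shows "has_order (\<lambda>z. u z + v z) (min m n)"
proof -
  note u = has_orderD[OF assms(1)] and v = has_orderD[OF assms(2)]
  obtain U where U: "u has_laurent_expansion U"
    using u(1) by (auto simp: meromorphic_on_def)
  obtain V where V: "v has_laurent_expansion V"
    using v(1) by (auto simp: meromorphic_on_def)
  have UV: "U \<noteq> 0" "V \<noteq> 0"
    using has_laurent_expansion_frequently_nonzero_iff[of u 0 U]
      has_laurent_expansion_frequently_nonzero_iff[of v 0 V] U V u v by auto
  then have sub: "fls_subdegree U = m" "fls_subdegree V = n"
    using has_laurent_expansion_zorder_0[OF U] has_laurent_expansion_zorder_0[OF V] u v by auto
  have UV': "(\<lambda>z. u z + v z) has_laurent_expansion U + V"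
    by (intro laurent_expansion_intros U V)
  have "U + V \<noteq> 0"
    using sub assms(3) by (metis add_eq_0_iff2 fls_uminus_subdegree)
  then have "\<exists>\<^sub>F z in at 0. u z + v z \<noteq> 0"
    using has_laurent_expansion_frequently_nonzero_iff[of "\<lambda>z. u z + v z" 0 "U + V"] UV' by auto
  moreover have "zorder (\<lambda>z. u z + v z) 0 = min m n"
    using zorder_add1[of u 0 v] zorder_add2[of u 0 v] u v assms(3) by (cases "m < n") auto
  ultimately show ?thesis
    using u(1) v(1) by (intro has_orderI meromorphic_intros) auto
qed

lemma has_order_0I:
  assumes "u analytic_on {0}" "u 0 \<noteq> 0"
  shows "has_order u 0"
proof -
  have "isCont u 0" using assms(1) by (simp add: analytic_at_imp_isCont)
  then have "\<forall>\<^sub>F z in at 0. u z \<noteq> 0"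
    using assms(2) unfolding isCont_def by (rule tendsto_imp_eventually_ne)
  then show ?thesis
    using assms zorder_eq_0I analytic_on_imp_meromorphic_on unfolding has_order_def by blast
qed

lemma has_order_1I:
  assumes "u analytic_on {0}" "u 0 = 0" "deriv u 0 \<noteq> 0"
  shows "has_order u 1"
proof -
  obtain S where S: "open S" "0 \<in> S" "u holomorphic_on S"
    using assms(1) by (auto simp: analytic_at)
  have *: "zorder u 0 = 1"
    using zorder_zero_eqI'[of u 0 1] assms by auto
  have "\<exists>\<^sub>F z in at 0. u z \<noteq> 0"
  proof (rule ccontr)
    assume "\<not> ?thesis"
    then have "\<forall>\<^sub>F z in at 0. u z = 0" by (simp add: frequently_def)
    then have "\<forall>\<^sub>F z in nhds 0. u z = 0" using assms(2)
      by (auto simp: eventually_at_filter elim: eventually_mono)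
    then have "deriv u 0 = deriv (\<lambda>_. 0) 0" by (intro deriv_cong_ev) auto
    then show False using assms(3) by simp
  qed
  then show ?thesis
    using * assms(1) by (intro has_orderI analytic_on_imp_meromorphic_on) auto
qed

section \<open>Topology of the curve\<close>

lemma topspace_curve [simp]: "topspace (curve f) = insert None (Some ` affine_curve f)"
  by (simp add: curve_def)

lemma mem_affine_curve [simp]: "(x, y) \<in> affine_curve f \<longleftrightarrow> y\<^sup>2 = poly f x"
  by (simp add: affine_curve_def)

lemma closed_affine_curve: "closed (affine_curve f)"
proof -
  have "affine_curve f = {z. (snd z)\<^sup>2 = poly f (fst z)}"
    by (auto simp: affine_curve_def)
  then show ?thesis
    by (auto intro!: closed_Collect_eq continuous_intros)
qed

lemma openin_curve_affine:
  assumes "open W"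
  shows "openin (curve f) (Some ` (affine_curve f \<inter> W))"
  using assms unfolding curve_def by (auto simp: openin_open)

text \<open>The part of the affine curve over a disc is bounded because \<open>f\<close> is bounded there, so it is
  compact, and its complement is a neighbourhood of infinity.\<close>

lemma openin_curve_infinity:
  "openin (curve f) (insert None (Some ` {(x, y). (x, y) \<in> affine_curve f \<and> cmod x > M}))"
proof -
  define C where "C = affine_curve f \<inter> {z. cmod (fst z) \<le> M}"
  have closed: "closed C"
    unfolding C_def
    by (intro closed_Int closed_affine_curve closed_Collect_le continuous_intros)
  have "compact (poly f ` cball 0 M)"
    by (intro compact_continuous_image continuous_intros) auto
  then obtain B where B: "\<And>x. cmod x \<le> M \<Longrightarrow> cmod (poly f x) \<le> B"
    by (force dest!: compact_imp_bounded simp: bounded_iff)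
  have "C \<subseteq> cball 0 M \<times> cball 0 (1 + B)"
  proof
    fix z assume z: "z \<in> C"
    obtain x y where [simp]: "z = (x, y)" by (cases z)
    have x: "cmod x \<le> M" and "(cmod y)\<^sup>2 \<le> B"
      using z B[of x] by (auto simp: C_def norm_power[symmetric])
    moreover have "cmod y \<le> 1 + (cmod y)\<^sup>2"
      using zero_le_power2[of "cmod y - 1"] norm_ge_zero[of y]
      unfolding power2_diff one_power2 by linarith
    ultimately show "z \<in> cball 0 M \<times> cball 0 (1 + B)" by simp
  qed
  then have "bounded C"
    by (rule bounded_subset[rotated]) (intro bounded_Times bounded_cball)
  then have "compact C" using closed by (simp add: compact_eq_bounded_closed)
  moreover have "{(x, y). (x, y) \<in> affine_curve f \<and> cmod x > M} = affine_curve f - C"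
    by (auto simp: C_def)
  moreover have "C \<subseteq> affine_curve f" by (auto simp: C_def)
  ultimately show ?thesis
    unfolding curve_def openin_Alexandroff_compactification
    by (intro disjI2 exI[of _ C])
       (auto simp: compactin_subtopology closed intro: closed_subset)
qed

lemma infinity_neighbourhood:
  assumes "openin (curve f) U" "None \<in> U"
  obtains M where "\<And>x y. (x, y) \<in> affine_curve f \<Longrightarrow> cmod x > M \<Longrightarrow> Some (x, y) \<in> U"
proof -
  obtain C where C: "compactin (top_of_set (affine_curve f)) C"
      and U: "U = insert None (Some ` (affine_curve f - C))"
    using assms unfolding curve_def openin_Alexandroff_compactification by auto
  from C have "bounded (fst ` C)"
    by (auto simp: compactin_subtopology intro!: compact_imp_bounded compact_continuous_image
        continuous_intros)
  then obtain M where "\<And>z. z \<in> C \<Longrightarrow> cmod (fst z) \<le> M"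
    by (auto simp: bounded_iff)
  then show ?thesis
    by (intro that[of M]) (force simp: U)
qed

section \<open>Independence of the parametrisation\<close>

lemma local_parametrisation_eventually:
  assumes "local_parametrisation f P \<gamma>" "openin (curve f) U" "P \<in> U"
  shows "\<forall>\<^sub>F z in nhds 0. \<gamma> z \<in> U"
proof -
  obtain r where r: "r > 0" "continuous_map (top_of_set (ball 0 r)) (curve f) \<gamma>"
    using assms(1) by (auto simp: local_parametrisation_def)
  have "openin (top_of_set (ball 0 r)) {z \<in> ball 0 r. \<gamma> z \<in> U}"
    using r(2) assms(2) unfolding continuous_map_def by auto
  then have "open {z \<in> ball 0 r. \<gamma> z \<in> U}"
    using openin_open_trans by blast
  moreover have "0 \<in> {z \<in> ball 0 r. \<gamma> z \<in> U}"
    using assms(1,3) r(1) by (auto simp: local_parametrisation_def)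
  ultimately show ?thesis
    unfolding eventually_nhds by blast
qed

lemma local_parametrisation_analytic:
  assumes "local_parametrisation f (Some p) \<gamma>" "p \<in> affine_curve f"
  shows "(\<lambda>z. xcoord (\<gamma> z)) analytic_on {0}" "(\<lambda>z. ycoord (\<gamma> z)) analytic_on {0}"
    "\<forall>\<^sub>F z in nhds 0. \<gamma> z \<in> Some ` affine_curve f"
proof -
  obtain r where r: "r > 0"
      "(\<lambda>z. xcoord (\<gamma> z)) holomorphic_on {z \<in> ball 0 r. \<gamma> z \<noteq> None}"
      "(\<lambda>z. ycoord (\<gamma> z)) holomorphic_on {z \<in> ball 0 r. \<gamma> z \<noteq> None}"
    using assms(1) by (auto simp: local_parametrisation_def)
  show *: "\<forall>\<^sub>F z in nhds 0. \<gamma> z \<in> Some ` affine_curve f"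
    using openin_curve_affine[of UNIV f] assms
    by (intro local_parametrisation_eventually[OF assms(1)]) auto
  have "\<forall>\<^sub>F z in nhds 0. z \<in> ball (0::complex) r"
    using r(1) by (intro eventually_nhds_in_open) auto
  with * have "\<forall>\<^sub>F z in nhds 0. z \<in> {z \<in> ball 0 r. \<gamma> z \<noteq> None}"
    by eventually_elim auto
  then obtain S where S: "open S" "0 \<in> S" "S \<subseteq> {z \<in> ball 0 r. \<gamma> z \<noteq> None}"
    unfolding eventually_nhds by blast
  then show "(\<lambda>z. xcoord (\<gamma> z)) analytic_on {0}" "(\<lambda>z. ycoord (\<gamma> z)) analytic_on {0}"
    using r(2,3) holomorphic_on_subset unfolding analytic_at by blast+
qed

text \<open>Injectivity keeps the parametrisation away from infinity off the centre, and continuity forces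
  \<open>x\<close> to tend to infinity there by the description of neighbourhoods above.\<close>

lemma local_parametrisation_infinity:
  assumes "local_parametrisation f None \<gamma>"
  obtains r where "r > 0"
    "\<And>z. z \<in> ball 0 r - {0} \<Longrightarrow> \<gamma> z \<in> Some ` affine_curve f"
    "(\<lambda>z. xcoord (\<gamma> z)) holomorphic_on ball 0 r - {0}"
    "(\<lambda>z. ycoord (\<gamma> z)) holomorphic_on ball 0 r - {0}"
    "filterlim (\<lambda>z. xcoord (\<gamma> z)) at_infinity (at 0)"
proof -
  obtain r where r: "r > 0" "inj_on \<gamma> (ball 0 r)"
      "continuous_map (top_of_set (ball 0 r)) (curve f) \<gamma>"
      "(\<lambda>z. xcoord (\<gamma> z)) holomorphic_on {z \<in> ball 0 r. \<gamma> z \<noteq> None}"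
      "(\<lambda>z. ycoord (\<gamma> z)) holomorphic_on {z \<in> ball 0 r. \<gamma> z \<noteq> None}"
    and 0: "\<gamma> 0 = None"
    using assms by (auto simp: local_parametrisation_def)
  have nz: "\<gamma> z \<noteq> None" if "z \<in> ball 0 r - {0}" for z
    using inj_onD[OF r(2), of z 0] that 0 r(1) by (metis DiffE centre_in_ball singletonI)
  then have eq: "{z \<in> ball 0 r. \<gamma> z \<noteq> None} = ball 0 r - {0}"
    using 0 by blast
  have mem: "\<gamma> z \<in> Some ` affine_curve f" if "z \<in> ball 0 r - {0}" for z
  proof -
    have "\<gamma> z \<in> topspace (curve f)"
      using r(3) that unfolding continuous_map_def by auto
    then show ?thesis using nz[OF that] by (metis insertE topspace_curve)
  qed
  have "\<forall>\<^sub>F z in at 0. M \<le> cmod (xcoord (\<gamma> z))" for M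
  proof -
    have "\<forall>\<^sub>F z in nhds 0. \<gamma> z \<in>
            insert None (Some ` {(x, y). (x, y) \<in> affine_curve f \<and> cmod x > M})"
      by (rule local_parametrisation_eventually[OF assms openin_curve_infinity]) auto
    then have "\<forall>\<^sub>F z in at 0. \<gamma> z \<in>
            insert None (Some ` {(x, y). (x, y) \<in> affine_curve f \<and> cmod x > M})"
      by (rule filter_leD[OF at_within_le_nhds])
    moreover have "\<forall>\<^sub>F z in at 0. z \<in> ball 0 r - {0}"
      using r(1) by (intro eventually_at_in_open) auto
    ultimately show ?thesis
      by eventually_elim (use nz in \<open>force simp: xcoord_def\<close>)
  qed
  then have "filterlim (\<lambda>z. xcoord (\<gamma> z)) at_infinity (at 0)"
    by (auto simp: filterlim_at_infinity[of 0])
  then show ?thesis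
    using r(1) mem r(4,5)[unfolded eq] that by blast
qed

text \<open>If \<open>\<gamma>\<^sub>0 (w Q) = Q\<close> for all \<open>Q\<close> near \<open>P\<close>, then \<open>\<gamma>\<^sub>0\<close> factors any
  other parametrisation \<open>\<gamma>\<close> at the same point as \<open>\<gamma> = \<gamma>\<^sub>0 \<circ> (w \<circ> \<gamma>)\<close>. Since \<open>\<gamma>\<close> is injective, so
  is \<open>w \<circ> \<gamma>\<close>; an injective holomorphic function has non-vanishing derivative and a holomorphic
  inverse, along which holomorphy and meromorphy are carried from the chosen \<open>\<gamma>\<close> to the explicit
  \<open>\<gamma>\<^sub>0\<close>.\<close>

lemma parametrisation_transfer:
  assumes "local_parametrisation f P \<gamma>\<^sub>0"
    and U: "openin (curve f) U" "P \<in> U"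
    and inv: "\<And>Q. Q \<in> U \<Longrightarrow> \<gamma>\<^sub>0 (w Q) = Q" and "w P = 0"
    and an: "\<And>\<gamma>. local_parametrisation f P \<gamma> \<Longrightarrow> (\<lambda>z. w (\<gamma> z)) analytic_on {0}"
  shows "local_parametrisation f P (parametrisation_at f P)"
    and "has_order (\<lambda>z. w (parametrisation_at f P z)) 1"
    and "holomorphic_at f h P \<Longrightarrow> (\<lambda>t. h (\<gamma>\<^sub>0 t)) analytic_on {0}"
    and "meromorphic_at f h P \<Longrightarrow> (\<lambda>t. h (\<gamma>\<^sub>0 t)) meromorphic_on {0}"
proof -
  define \<gamma> where "\<gamma> = parametrisation_at f P"
  define \<phi> where "\<phi> = (\<lambda>z. w (\<gamma> z))"
  show loc': "local_parametrisation f P (parametrisation_at f P)"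
    unfolding parametrisation_at_def by (rule someI[of "local_parametrisation f P", OF assms(1)])
  then have loc: "local_parametrisation f P \<gamma>" by (simp add: \<gamma>_def)
  then obtain r where r: "r > 0" "inj_on \<gamma> (ball 0 r)" and \<gamma>0: "\<gamma> 0 = P"
    by (auto simp: local_parametrisation_def)
  obtain S where S: "open S" "0 \<in> S" "\<phi> holomorphic_on S"
    using an[OF loc] by (auto simp: analytic_at \<phi>_def)
  have "\<forall>\<^sub>F z in nhds 0. \<gamma> z \<in> U"
    by (rule local_parametrisation_eventually[OF loc U])
  then obtain T where T: "open T" "0 \<in> T" "\<And>z. z \<in> T \<Longrightarrow> \<gamma> z \<in> U"
    unfolding eventually_nhds by blast
  define V where "V = S \<inter> T \<inter> ball 0 r"
  have V: "open V" "0 \<in> V" "\<phi> holomorphic_on V"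
    using S T r by (auto simp: V_def intro: holomorphic_on_subset)
  have fac: "\<gamma>\<^sub>0 (\<phi> z) = \<gamma> z" if "z \<in> V" for z
    using inv[of "\<gamma> z"] T that by (auto simp: V_def \<phi>_def)
  have inj: "inj_on \<phi> V"
  proof (rule inj_onI)
    fix z z' assume "z \<in> V" "z' \<in> V" "\<phi> z = \<phi> z'"
    then show "z = z'"
      using fac[of z] fac[of z'] inj_onD[OF r(2), of z z'] by (auto simp: V_def)
  qed
  have \<phi>0: "\<phi> 0 = 0" using \<open>w P = 0\<close> by (simp add: \<phi>_def \<gamma>0)
  have \<phi>an: "\<phi> analytic_on {0}" using an[OF loc] by (simp add: \<phi>_def)
  have "deriv \<phi> 0 \<noteq> 0"
    using holomorphic_injective_imp_regular[OF V(3,1) inj V(2)] .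
  then show "has_order (\<lambda>z. w (parametrisation_at f P z)) 1"
    using has_order_1I[OF \<phi>an \<phi>0] unfolding \<phi>_def \<gamma>_def by blast
  obtain \<kappa> where \<kappa>: "\<kappa> holomorphic_on \<phi> ` V" "\<And>z. z \<in> V \<Longrightarrow> \<kappa> (\<phi> z) = z"
    using holomorphic_has_inverse[OF V(3,1) inj] by metis
  have op: "open (\<phi> ` V)" using open_mapping_thm3[OF V(3,1) inj] .
  have mem0: "0 \<in> \<phi> ` V" using imageI[OF V(2), of \<phi>] \<phi>0 by simp
  have \<kappa>0: "\<kappa> 0 = 0" using \<kappa>(2)[of 0] V(2) \<phi>0 by simp
  have \<kappa>an: "\<kappa> analytic_on {0}" using analytic_at[of \<kappa> 0] \<kappa>(1) op mem0 by metis
  have ev: "\<forall>\<^sub>F t in nhds 0. h (\<gamma>\<^sub>0 t) = h (\<gamma> (\<kappa> t))"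
    unfolding eventually_nhds
  proof (intro exI[of _ "\<phi> ` V"] conjI ballI op mem0)
    fix t assume "t \<in> \<phi> ` V"
    then obtain z where "z \<in> V" "t = \<phi> z" by blast
    then show "h (\<gamma>\<^sub>0 t) = h (\<gamma> (\<kappa> t))" using \<kappa>(2) fac by metis
  qed
  show "(\<lambda>t. h (\<gamma>\<^sub>0 t)) analytic_on {0}" if "holomorphic_at f h P"
  proof -
    have "(\<lambda>z. h (\<gamma> z)) analytic_on {0}"
      using that by (simp add: holomorphic_at_def \<gamma>_def o_def)
    then have "((\<lambda>z. h (\<gamma> z)) \<circ> \<kappa>) analytic_on {0}"
      using \<kappa>0 by (intro analytic_on_compose \<kappa>an) auto
    then show ?thesis
      using analytic_at_cong[OF ev refl] by (simp add: o_def)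
  qed
  show "(\<lambda>t. h (\<gamma>\<^sub>0 t)) meromorphic_on {0}" if "meromorphic_at f h P"
  proof -
    have "(\<lambda>z. h (\<gamma> z)) meromorphic_on {0}"
      using that by (simp add: meromorphic_at_def \<gamma>_def o_def)
    then have "(\<lambda>t. h (\<gamma> (\<kappa> t))) meromorphic_on {0}"
      by (rule meromorphic_on_compose[OF _ \<kappa>an]) (use \<kappa>0 in auto)
    moreover have "\<forall>\<^sub>F t in at 0. h (\<gamma>\<^sub>0 t) = h (\<gamma> (\<kappa> t))"
      by (rule filter_leD[OF at_within_le_nhds ev])
    ultimately show ?thesis
      by (subst meromorphic_on_cong[where g = "\<lambda>t. h (\<gamma> (\<kappa> t))"]) auto
  qed
qed

lemma local_parametrisation_affineI:
  assumes "r > 0" "X holomorphic_on ball 0 r" "Y holomorphic_on ball 0 r"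
    and "\<And>t. t \<in> ball 0 r \<Longrightarrow> (Y t)\<^sup>2 = poly f (X t)"
    and "inj_on (\<lambda>t. (X t, Y t)) (ball 0 r)"
  shows "local_parametrisation f (Some (X 0, Y 0)) (\<lambda>t. Some (X t, Y t))"
proof -
  have "continuous_on (ball 0 r) (\<lambda>t. (X t, Y t))"
    using assms(2,3) by (intro continuous_on_Pair holomorphic_on_imp_continuous_on)
  then have "continuous_map (top_of_set (ball 0 r)) (top_of_set (affine_curve f)) (\<lambda>t. (X t, Y t))"
    using assms(4) by (auto simp: continuous_map_in_subtopology)
  from continuous_map_compose[OF this continuous_map_Some]
  have "continuous_map (top_of_set (ball 0 r)) (curve f) (\<lambda>t. Some (X t, Y t))"
    by (simp add: curve_def o_def)
  moreover have "inj_on (\<lambda>t. Some (X t, Y t)) (ball 0 r)"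
    using assms(5) by (auto simp: inj_on_def)
  ultimately show ?thesis
    using assms(1-3) unfolding local_parametrisation_def
    by (auto simp: xcoord_def ycoord_def intro!: exI[of _ r])
qed

lemma local_parametrisation_infinityI:
  assumes "r > 0" "X holomorphic_on ball 0 r - {0}" "Y holomorphic_on ball 0 r - {0}"
    and "\<And>t. t \<in> ball 0 r - {0} \<Longrightarrow> (Y t)\<^sup>2 = poly f (X t)"
    and "inj_on (\<lambda>t. (X t, Y t)) (ball 0 r - {0})"
    and lim: "filterlim X at_infinity (at 0)"
  shows "local_parametrisation f None (\<lambda>t. if t = 0 then None else Some (X t, Y t))"
    (is "local_parametrisation f None ?\<gamma>")
proof -
  have cont: "continuous_on (ball 0 r - {0}) (\<lambda>t. (X t, Y t))"
    using assms(2,3) by (intro continuous_on_Pair holomorphic_on_imp_continuous_on)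
  have "openin (top_of_set (ball 0 r)) {t \<in> ball 0 r. ?\<gamma> t \<in> U}"
    if U: "openin (curve f) U" for U
  proof -
    have "openin (top_of_set (affine_curve f)) {p \<in> affine_curve f. Some p \<in> U}"
      using openin_continuous_map_preimage[OF continuous_map_Some U[unfolded curve_def]]
      by simp
    then obtain W where W: "open W" "{p \<in> affine_curve f. Some p \<in> U} = affine_curve f \<inter> W"
      by (auto simp: openin_open)
    define A where "A = {t \<in> ball 0 r - {0}. (X t, Y t) \<in> W}"
    have "A = (ball 0 r - {0}) \<inter> (\<lambda>t. (X t, Y t)) -` W"
      unfolding A_def by blast
    then have A: "open A"
      using continuous_open_preimage[OF cont open_delete[OF open_ball] W(1)] by simp
    have A': "t \<in> A \<longleftrightarrow> t \<in> ball 0 r \<and> t \<noteq> 0 \<and> ?\<gamma> t \<in> U" for t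
    proof (cases "t \<in> ball 0 r - {0}")
      case True
      then have "(X t, Y t) \<in> affine_curve f" using assms(4) by simp
      then have "Some (X t, Y t) \<in> U \<longleftrightarrow> (X t, Y t) \<in> W" using W(2) by blast
      then show ?thesis using True unfolding A_def by simp
    qed (auto simp: A_def)
    show ?thesis
    proof (cases "None \<in> U")
      case False
      have "t \<in> {t \<in> ball 0 r. ?\<gamma> t \<in> U} \<longleftrightarrow> t \<in> A" for t
        using A'[of t] False by (cases "t = 0") simp_all
      then have "{t \<in> ball 0 r. ?\<gamma> t \<in> U} = A" by blast
      moreover have "A \<subseteq> ball 0 r" unfolding A_def by blast
      ultimately show ?thesis
        using open_openin_trans[OF open_ball A] by metis
    next
      case True
      obtain M where M: "\<And>x y. (x, y) \<in> affine_curve f \<Longrightarrow> cmod x > M \<Longrightarrow> Some (x, y) \<in> U"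
        using infinity_neighbourhood[OF U True] by blast
      have "\<forall>\<^sub>F t in at 0. cmod (X t) \<ge> \<bar>M\<bar> + 1"
        using lim by (auto simp: filterlim_at_infinity[of 0])
      moreover have "\<forall>\<^sub>F t in at 0. t \<in> ball 0 r - {0}"
        using assms(1) by (intro eventually_at_in_open) auto
      ultimately have "\<forall>\<^sub>F t in at 0. ?\<gamma> t \<in> U \<and> t \<in> ball 0 r"
        by eventually_elim (use assms(4) M in force)
      then have "\<forall>\<^sub>F t in nhds 0. ?\<gamma> t \<in> U \<and> t \<in> ball 0 r"
        unfolding eventually_at_filter by (rule eventually_mono) (use assms(1) True in simp)
      then obtain B where B: "open B" "0 \<in> B" "\<And>t. t \<in> B \<Longrightarrow> ?\<gamma> t \<in> U \<and> t \<in> ball 0 r"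
        unfolding eventually_nhds by blast
      have "{t \<in> ball 0 r. ?\<gamma> t \<in> U} = A \<union> B"
      proof (intro set_eqI iffI)
        fix t assume "t \<in> {t \<in> ball 0 r. ?\<gamma> t \<in> U}"
        then show "t \<in> A \<union> B" using A'[of t] B(2) by (cases "t = 0") simp_all
      next
        fix t assume "t \<in> A \<union> B"
        then show "t \<in> {t \<in> ball 0 r. ?\<gamma> t \<in> U}" using A'[of t] B(3)[of t] by blast
      qed
      moreover have "A \<union> B \<subseteq> ball 0 r" using B(3) unfolding A_def by blast
      ultimately show ?thesis
        using open_openin_trans[OF open_ball open_Un[OF A B(1)]] by metis
    qed
  qed
  then have "continuous_map (top_of_set (ball 0 r)) (curve f) ?\<gamma>"
    using assms(4) unfolding continuous_map_def by auto
  moreover have "inj_on ?\<gamma> (ball 0 r)"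
    using assms(5) by (auto simp: inj_on_def)
  moreover have "{t \<in> ball 0 r. ?\<gamma> t \<noteq> None} = ball 0 r - {0}" by auto
  moreover have "(\<lambda>t. xcoord (?\<gamma> t)) holomorphic_on ball 0 r - {0}"
    by (rule holomorphic_transform[OF assms(2)]) (auto simp: xcoord_def)
  moreover have "(\<lambda>t. ycoord (?\<gamma> t)) holomorphic_on ball 0 r - {0}"
    by (rule holomorphic_transform[OF assms(3)]) (auto simp: ycoord_def)
  ultimately show ?thesis
    using assms(1) unfolding local_parametrisation_def by (intro conjI exI[of _ r]) auto
qed

section \<open>Explicit parametrisations\<close>

lemma local_inverse:
  fixes u :: "complex \<Rightarrow> complex"
  assumes "u holomorphic_on S" "open S" "\<xi> \<in> S" "deriv u \<xi> \<noteq> 0"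
  obtains \<epsilon> \<psi> where "\<epsilon> > 0" "ball \<xi> \<epsilon> \<subseteq> S" "open (u ` ball \<xi> \<epsilon>)"
    "\<psi> holomorphic_on u ` ball \<xi> \<epsilon>" "\<And>x. x \<in> ball \<xi> \<epsilon> \<Longrightarrow> \<psi> (u x) = x"
proof -
  obtain \<epsilon> where \<epsilon>: "\<epsilon> > 0" "ball \<xi> \<epsilon> \<subseteq> S" "open (u ` ball \<xi> \<epsilon>)" "inj_on u (ball \<xi> \<epsilon>)"
    using has_complex_derivative_locally_invertible[OF assms(1,3,2,4)] by metis
  have "u holomorphic_on ball \<xi> \<epsilon>"
    using assms(1) \<epsilon>(2) holomorphic_on_subset by blast
  then obtain \<psi> where "\<psi> holomorphic_on u ` ball \<xi> \<epsilon>" "\<And>x. x \<in> ball \<xi> \<epsilon> \<Longrightarrow> \<psi> (u x) = x"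
    using holomorphic_has_inverse[OF _ open_ball \<epsilon>(4)] by metis
  then show ?thesis using that \<epsilon> by blast
qed

lemma square_preimage_ball:
  fixes W :: "complex set"
  assumes "open W" "0 \<in> W"
  obtains r where "r > 0" "\<And>t. t \<in> ball 0 r \<Longrightarrow> t\<^sup>2 \<in> W"
proof -
  have "open ((\<lambda>t. t\<^sup>2) -` W)"
    by (rule open_vimage[OF assms(1)]) (intro continuous_intros)
  then obtain r where "r > 0" "ball 0 r \<subseteq> (\<lambda>t. t\<^sup>2) -` W"
    using assms(2) openE[of "(\<lambda>t. t\<^sup>2) -` W" 0] by auto
  then show ?thesis using that by blast
qed

text \<open>Odd degree means that there is a single point at infinity and that it is a branch point of
  \<open>x\<close>; simple roots make the affine curve smooth.\<close>

locale odd_hyperelliptic =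
  fixes f :: "complex poly" and g :: nat
  assumes degree_f: "degree f = 2 * g + 1"
    and simple_roots: "\<And>a. poly f a = 0 \<Longrightarrow> poly (pderiv f) a \<noteq> 0"
begin

lemma f_nonzero: "f \<noteq> 0"
  using degree_f by auto

text \<open>As \<open>f'(a) \<noteq> 0\<close>, \<open>f\<close> has a local inverse \<open>\<psi>\<close> at \<open>a\<close>, and \<open>y\<close> is a coordinate: the curve is
  parametrised by \<open>t \<mapsto> (\<psi> (t\<^sup>2), t)\<close>.\<close>

lemma branch_point_parametrisation:
  assumes "poly f a = 0"
  defines "P \<equiv> Some (a, 0)"
  shows "local_parametrisation f P (parametrisation_at f P)"
    and "has_order (\<lambda>z. ycoord (parametrisation_at f P z)) 1"
    and "holomorphic_at f h P \<Longrightarrow>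
      \<exists>H V. H analytic_on {0} \<and> open V \<and> a \<in> V \<and>
        (\<forall>x y. x \<in> V \<longrightarrow> y\<^sup>2 = poly f x \<longrightarrow> h (Some (x, y)) = H y)"
proof -
  have "deriv (poly f) a = poly (pderiv f) a"
    by (intro DERIV_imp_deriv poly_DERIV)
  then have "deriv (poly f) a \<noteq> 0" using simple_roots[OF assms(1)] by simp
  moreover have "poly f holomorphic_on UNIV" by (intro holomorphic_intros)
  ultimately obtain \<epsilon> \<psi> where \<epsilon>: "\<epsilon> > 0" "open (poly f ` ball a \<epsilon>)"
    "\<psi> holomorphic_on poly f ` ball a \<epsilon>" "\<And>x. x \<in> ball a \<epsilon> \<Longrightarrow> \<psi> (poly f x) = x"
    using local_inverse[of "poly f" UNIV a] by (metis UNIV_I open_UNIV)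
  let ?W = "poly f ` ball a \<epsilon>"
  have "poly f a \<in> ?W" using \<epsilon>(1) by (intro imageI) simp
  then have W0: "0 \<in> ?W" using assms(1) by simp
  have \<psi>: "poly f (\<psi> s) = s" "\<psi> s \<in> ball a \<epsilon>" if "s \<in> ?W" for s
    using that \<epsilon>(4) by (auto simp del: mem_ball)
  obtain r where r: "r > 0" "\<And>t. t \<in> ball 0 r \<Longrightarrow> t\<^sup>2 \<in> ?W"
    by (rule square_preimage_ball[OF \<epsilon>(2) W0]) (rule that; assumption)
  define \<gamma>\<^sub>0 where "\<gamma>\<^sub>0 = (\<lambda>t. Some (\<psi> (t\<^sup>2), t))"
  have "\<psi> 0 = a" using \<epsilon>(1) \<epsilon>(4)[of a] assms(1) by simp
  moreover have "local_parametrisation f (Some (\<psi> (0\<^sup>2), 0)) \<gamma>\<^sub>0"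
    unfolding \<gamma>\<^sub>0_def
  proof (rule local_parametrisation_affineI[OF r(1)])
    have "(\<psi> \<circ> (\<lambda>t. t\<^sup>2)) holomorphic_on ball 0 r"
      using r(2) by (intro holomorphic_on_compose_gen[OF _ \<epsilon>(3)] holomorphic_intros) blast
    then show "(\<lambda>t. \<psi> (t\<^sup>2)) holomorphic_on ball 0 r" by (simp add: o_def)
    show "t\<^sup>2 = poly f (\<psi> (t\<^sup>2))" if "t \<in> ball 0 r" for t
      using \<psi>(1)[OF r(2)[OF that]] by simp
  qed (auto simp: inj_on_def)
  ultimately have loc: "local_parametrisation f P \<gamma>\<^sub>0" by (simp add: P_def)
  define U where "U = Some ` (affine_curve f \<inter> (ball a \<epsilon> \<times> UNIV))"
  have U: "openin (curve f) U" "P \<in> U"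
    using \<epsilon>(1) assms(1) unfolding U_def P_def
    by (auto intro!: openin_curve_affine open_Times)
  have inv: "\<gamma>\<^sub>0 (ycoord Q) = Q" if "Q \<in> U" for Q
    using that \<epsilon>(4) unfolding U_def by (auto simp: \<gamma>\<^sub>0_def ycoord_def simp del: mem_ball)
  have yP: "ycoord P = 0" by (simp add: P_def ycoord_def)
  have an: "(\<lambda>z. ycoord (\<gamma> z)) analytic_on {0}" if "local_parametrisation f P \<gamma>" for \<gamma>
    using local_parametrisation_analytic(2)[of f "(a, 0)" \<gamma>] that assms(1) by (simp add: P_def)
  note transfer = parametrisation_transfer[OF loc U inv yP an]
  show "local_parametrisation f P (parametrisation_at f P)"
    by (rule transfer(1))
  show "has_order (\<lambda>z. ycoord (parametrisation_at f P z)) 1"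
    by (rule transfer(2))
  show "\<exists>H V. H analytic_on {0} \<and> open V \<and> a \<in> V \<and>
        (\<forall>x y. x \<in> V \<longrightarrow> y\<^sup>2 = poly f x \<longrightarrow> h (Some (x, y)) = H y)" if "holomorphic_at f h P"
  proof (intro exI conjI allI impI)
    show "(\<lambda>t. h (\<gamma>\<^sub>0 t)) analytic_on {0}" by (rule transfer(3)[OF _ _ that])
    show "open (ball a \<epsilon>)" "a \<in> ball a \<epsilon>" using \<epsilon>(1) by auto
    show "h (Some (x, y)) = h (\<gamma>\<^sub>0 y)" if "x \<in> ball a \<epsilon>" "y\<^sup>2 = poly f x" for x y
      using inv[of "Some (x, y)"] that unfolding U_def by (auto simp: ycoord_def)
  qed
qed

text \<open>Here \<open>x - a\<close> is a coordinate, and \<open>y\<close> is the branch of the square root of \<open>f(x)\<close> singled out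
  by \<open>Re (y / b) > 0\<close>.\<close>

lemma regular_point_parametrisation:
  assumes "b\<^sup>2 = poly f a" "b \<noteq> 0"
  defines "P \<equiv> Some (a, b)"
  shows "local_parametrisation f P (parametrisation_at f P)"
    and "has_order (\<lambda>z. xcoord (parametrisation_at f P z) - a) 1"
    and "holomorphic_at f h P \<Longrightarrow>
      \<exists>H. H analytic_on {0} \<and>
        (\<forall>x y. y\<^sup>2 = poly f x \<longrightarrow> Re (y / b) > 0 \<longrightarrow> h (Some (x, y)) = H (x - a))"
proof -
  define q where "q = (\<lambda>t. poly f (a + t) / b\<^sup>2)"
  have q0: "q 0 = 1" using assms(2) by (simp add: q_def assms(1)[symmetric])
  have "open (q -` ball 1 1)"
    unfolding q_def by (rule open_vimage[OF open_ball]) (intro continuous_intros; use assms(2) in simp)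
  then obtain r where r: "r > 0" "ball 0 r \<subseteq> q -` ball 1 1"
    using q0 openE[of "q -` ball 1 1" 0] by auto
  have nonneg: "q t \<notin> \<real>\<^sub>\<le>\<^sub>0" if "t \<in> ball 0 r" for t
  proof
    assume neg: "q t \<in> \<real>\<^sub>\<le>\<^sub>0"
    have "cmod (1 - q t) < 1" using r(2) that by (auto simp: dist_norm)
    then have "Re (1 - q t) < 1" using complex_Re_le_cmod[of "1 - q t"] by linarith
    then show False using neg by (auto simp: complex_nonpos_Reals_iff)
  qed
  define \<gamma>\<^sub>0 where "\<gamma>\<^sub>0 = (\<lambda>t. Some (a + t, b * csqrt (q t)))"
  have "local_parametrisation f (Some (a + 0, b * csqrt (q 0))) \<gamma>\<^sub>0"
    unfolding \<gamma>\<^sub>0_def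
  proof (rule local_parametrisation_affineI[OF r(1)])
    have "q holomorphic_on ball 0 r"
      unfolding q_def using assms(2) by (intro holomorphic_intros) auto
    then show "(\<lambda>t. b * csqrt (q t)) holomorphic_on ball 0 r"
      using nonneg by (intro holomorphic_intros) auto
    show "(b * csqrt (q t))\<^sup>2 = poly f (a + t)" for t
      using assms(2) by (simp add: power_mult_distrib q_def)
  qed (auto simp: inj_on_def intro!: holomorphic_intros)
  then have loc: "local_parametrisation f P \<gamma>\<^sub>0" by (simp add: P_def q0)
  define w where "w = (\<lambda>Q. xcoord Q - a)"
  define U where "U = Some ` (affine_curve f \<inter> {p. Re (snd p / b) > 0})"
  have "open {p :: complex \<times> complex. Re (snd p / b) > 0}"
    using assms(2) by (intro open_Collect_less continuous_intros) auto
  then have U: "openin (curve f) U" "P \<in> U"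
    using assms(1,2) unfolding U_def P_def by (auto intro!: openin_curve_affine)
  have inv: "\<gamma>\<^sub>0 (w Q) = Q" if "Q \<in> U" for Q
  proof -
    obtain x y where Q: "Q = Some (x, y)" "y\<^sup>2 = poly f x" "Re (y / b) > 0"
      using \<open>Q \<in> U\<close> by (auto simp: U_def)
    have "csqrt ((y / b)\<^sup>2) = y / b" using Q(3) by (intro csqrt_square) auto
    then have "b * csqrt (poly f x / b\<^sup>2) = y"
      using Q(2) assms(2) by (simp add: power_divide)
    then show ?thesis by (simp add: Q(1) \<gamma>\<^sub>0_def w_def xcoord_def q_def)
  qed
  have wP: "w P = 0" by (simp add: w_def P_def xcoord_def)
  have an: "(\<lambda>z. w (\<gamma> z)) analytic_on {0}" if "local_parametrisation f P \<gamma>" for \<gamma>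
    using local_parametrisation_analytic(1)[of f "(a, b)" \<gamma>] that assms(1)
    unfolding w_def P_def by (intro analytic_intros) auto
  note transfer = parametrisation_transfer[OF loc U inv wP an]
  show "local_parametrisation f P (parametrisation_at f P)"
    by (rule transfer(1))
  show "has_order (\<lambda>z. xcoord (parametrisation_at f P z) - a) 1"
    using transfer(2) by (simp add: w_def)
  show "\<exists>H. H analytic_on {0} \<and>
        (\<forall>x y. y\<^sup>2 = poly f x \<longrightarrow> Re (y / b) > 0 \<longrightarrow> h (Some (x, y)) = H (x - a))"
    if "holomorphic_at f h P"
  proof (intro exI conjI allI impI)
    show "(\<lambda>t. h (\<gamma>\<^sub>0 t)) analytic_on {0}" by (rule transfer(3)[OF _ _ that])
    show "h (Some (x, y)) = h (\<gamma>\<^sub>0 (x - a))" if "y\<^sup>2 = poly f x" "Re (y / b) > 0" for x y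
      using inv[of "Some (x, y)"] that unfolding U_def w_def by (auto simp: xcoord_def)
  qed
qed

lemma poly_f_reflect:
  assumes "x \<noteq> 0"
  shows "poly f x = x ^ (2 * g + 1) * poly (reflect_poly f) (1 / x)"
  using poly_reflect_poly_nz[of "1 / x" f] assms
  by (simp add: degree_f inverse_eq_divide field_simps)

text \<open>At infinity \<open>1 / x\<close> has order 2 and \<open>1 / y\<close> has order \<open>2 g + 1\<close>, so the quotient \<open>x^g / y\<close>
  has order 1.\<close>

definition infinity_coordinate :: "point \<Rightarrow> complex" where
  "infinity_coordinate Q = (case Q of None \<Rightarrow> 0 | Some (x, y) \<Rightarrow> x ^ g / y)"

text \<open>With \<open>s = 1 / x\<close> and \<open>F\<close> the reflected polynomial of \<open>f\<close>, the equation of the curve becomes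
  \<open>w\<^sup>2 = s / F(s)\<close> for \<open>w = x^g / y\<close>. As \<open>F(0) \<noteq> 0\<close>, the right-hand side \<open>G\<close> is invertible near 0,
  which recovers \<open>x\<close> from \<open>w\<^sup>2\<close>, and then \<open>y\<close> from \<open>w\<close>, as at a branch point.\<close>

lemma infinity_chart:
  obtains M \<gamma>\<^sub>0 where "M > 0" "local_parametrisation f None \<gamma>\<^sub>0"
    "\<And>x. cmod x > M \<Longrightarrow> poly f x \<noteq> 0"
    "\<And>Q. Q = None \<or> Q \<in> Some ` {(x, y). (x, y) \<in> affine_curve f \<and> cmod x > M} \<Longrightarrow>
      \<gamma>\<^sub>0 (infinity_coordinate Q) = Q"
proof -
  define F where "F = reflect_poly f"
  define G where "G = (\<lambda>s. s / poly F s)"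
  define S where "S = {s. poly F s \<noteq> 0}"
  have S: "open S"
    unfolding S_def by (intro open_Collect_neq continuous_intros)
  have F0: "poly F 0 \<noteq> 0" using f_nonzero by (simp add: F_def)
  have holG: "G holomorphic_on S" unfolding G_def S_def by (intro holomorphic_intros) auto
  have "(G has_field_derivative 1 / poly F 0) (at 0)"
    unfolding G_def using F0 by (auto intro!: derivative_eq_intros poly_DERIV simp: field_simps)
  then have "deriv G 0 \<noteq> 0" using F0 by (simp add: DERIV_imp_deriv)
  moreover have "0 \<in> S" using F0 by (simp add: S_def)
  ultimately obtain \<epsilon> \<psi> where \<epsilon>: "\<epsilon> > 0" "ball 0 \<epsilon> \<subseteq> S" "open (G ` ball 0 \<epsilon>)"
    "\<psi> holomorphic_on G ` ball 0 \<epsilon>" "\<And>x. x \<in> ball 0 \<epsilon> \<Longrightarrow> \<psi> (G x) = x"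
    using local_inverse[OF holG S] by metis
  let ?W = "G ` ball 0 \<epsilon>"
  have G0: "G 0 = 0" by (simp add: G_def)
  have W0: "0 \<in> ?W" using imageI[of 0 "ball 0 \<epsilon>" G] \<epsilon>(1) G0 by simp
  have \<psi>: "G (\<psi> s) = s" "\<psi> s \<in> S" if "s \<in> ?W" for s
    using that \<epsilon>(2,5) by (auto simp del: mem_ball)
  have \<psi>0: "\<psi> 0 = 0" using \<epsilon>(1) \<epsilon>(5)[of 0] G0 by simp
  obtain r where r: "r > 0" "\<And>t. t \<in> ball 0 r \<Longrightarrow> t\<^sup>2 \<in> ?W"
    by (rule square_preimage_ball[OF \<epsilon>(3) W0]) (rule that; assumption)
  define X where "X = (\<lambda>t. 1 / \<psi> (t\<^sup>2))"
  define Y where "Y = (\<lambda>t. X t ^ g / t)"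
  have \<psi>nz: "\<psi> (t\<^sup>2) \<noteq> 0" if "t \<in> ball 0 r - {0}" for t
    using \<psi>(1)[OF r(2), of t] that G0 by auto
  have "(\<psi> \<circ> (\<lambda>t. t\<^sup>2)) holomorphic_on ball 0 r"
    using r(2) by (intro holomorphic_on_compose_gen[OF _ \<epsilon>(4)] holomorphic_intros) blast
  then have hol: "(\<lambda>t. \<psi> (t\<^sup>2)) holomorphic_on ball 0 r" by (simp add: o_def)
  have X: "X holomorphic_on ball 0 r - {0}"
    unfolding X_def using hol \<psi>nz by (intro holomorphic_intros) (auto intro: holomorphic_on_subset)
  have Y: "Y holomorphic_on ball 0 r - {0}"
    unfolding Y_def using X by (intro holomorphic_intros) auto
  have XY: "(Y t)\<^sup>2 = poly f (X t)" if t: "t \<in> ball 0 r - {0}" for t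
  proof -
    let ?s = "\<psi> (t\<^sup>2)"
    have s: "?s \<noteq> 0" "poly F ?s \<noteq> 0" "t\<^sup>2 = ?s / poly F ?s"
      using \<psi>nz[OF t] \<psi>[OF r(2), of t] t by (auto simp: S_def G_def)
    have "(Y t)\<^sup>2 = X t ^ (2 * g) / t\<^sup>2"
      by (simp add: Y_def power_divide power_mult[symmetric] mult.commute)
    also have "\<dots> = X t ^ (2 * g) / (?s / poly F ?s)" using s(3) by simp
    also have "\<dots> = X t ^ (2 * g + 1) * poly F (1 / X t)"
      using s(1,2) by (simp add: X_def)
    also have "\<dots> = poly f (X t)"
      using poly_f_reflect[of "X t"] s(1) by (simp add: X_def F_def)
    finally show ?thesis .
  qed
  have inj: "inj_on (\<lambda>t. (X t, Y t)) (ball 0 r - {0})"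
  proof (rule inj_onI)
    fix t t' assume *: "t \<in> ball 0 r - {0}" "t' \<in> ball 0 r - {0}" "(X t, Y t) = (X t', Y t')"
    have rec: "X s ^ g / Y s = s" if "s \<in> ball 0 r - {0}" for s
      using \<psi>nz[OF that] by (simp add: X_def Y_def)
    have "X t = X t'" "Y t = Y t'" using *(3) by simp_all
    then show "t = t'" using rec[OF *(1)] rec[OF *(2)] by metis
  qed
  have "isCont (\<lambda>t. \<psi> (t\<^sup>2)) 0"
    using holomorphic_on_imp_continuous_on[OF hol] r(1)
    by (simp add: continuous_on_eq_continuous_at)
  then have "((\<lambda>t. \<psi> (t\<^sup>2)) \<longlongrightarrow> 0) (at 0)" by (simp add: isCont_def \<psi>0)
  moreover have "\<forall>\<^sub>F t in at 0. \<psi> (t\<^sup>2) \<noteq> 0"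
    using eventually_at_in_open[OF open_ball, of 0 0 r] r(1)
    by (auto elim!: eventually_mono intro!: \<psi>nz)
  ultimately have "filterlim (\<lambda>t. \<psi> (t\<^sup>2)) (at 0) (at 0)"
    by (simp add: filterlim_at)
  from filterlim_compose[OF filterlim_inverse_at_infinity this]
  have lim: "filterlim X at_infinity (at 0)" by (simp add: X_def inverse_eq_divide)
  define \<gamma>\<^sub>0 where "\<gamma>\<^sub>0 = (\<lambda>t. if t = 0 then None else Some (X t, Y t))"
  show ?thesis
  proof (rule that)
    show "1 / \<epsilon> > 0" using \<epsilon>(1) by simp
    show "local_parametrisation f None \<gamma>\<^sub>0"
      unfolding \<gamma>\<^sub>0_def by (rule local_parametrisation_infinityI[OF r(1) X Y XY inj lim])
    have big: "x \<noteq> 0 \<and> 1 / x \<in> ball 0 \<epsilon>" if "cmod x > 1 / \<epsilon>" for x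
    proof -
      have "x \<noteq> 0" using that \<epsilon>(1) by auto
      then show ?thesis using that \<epsilon>(1) by (simp add: norm_divide field_simps)
    qed
    show nz: "poly f x \<noteq> 0" if "cmod x > 1 / \<epsilon>" for x
      using big[OF that] \<epsilon>(2) poly_f_reflect[of x] unfolding S_def F_def by auto
    show "\<gamma>\<^sub>0 (infinity_coordinate Q) = Q"
      if "Q = None \<or> Q \<in> Some ` {(x, y). (x, y) \<in> affine_curve f \<and> cmod x > 1 / \<epsilon>}" for Q
    proof (cases Q)
      case None
      then show ?thesis by (simp add: infinity_coordinate_def \<gamma>\<^sub>0_def)
    next
      case (Some p)
      obtain x y where p: "p = (x, y)" by (cases p)
      with that Some have xy: "y\<^sup>2 = poly f x" "cmod x > 1 / \<epsilon>" by auto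
      note x = big[OF xy(2)]
      have y: "y \<noteq> 0" using nz[OF xy(2)] xy(1) by auto
      let ?w = "x ^ g / y"
      have Fx: "poly F (1 / x) \<noteq> 0" using x \<epsilon>(2) by (auto simp: S_def)
      have "?w\<^sup>2 = x ^ (2 * g) / poly f x"
        by (simp add: power_divide power_mult[symmetric] mult.commute xy(1))
      also have "\<dots> = G (1 / x)"
        using x Fx by (simp add: G_def poly_f_reflect F_def)
      finally have "\<psi> (?w\<^sup>2) = 1 / x" using \<epsilon>(5) x by simp
      then have "X ?w = x" "Y ?w = y" using x y by (auto simp: X_def Y_def)
      then show ?thesis
        using x y by (simp add: Some p infinity_coordinate_def \<gamma>\<^sub>0_def)
    qed
  qed
qed

text \<open>The identity \<open>w\<^sup>2 = s / F(s)\<close> with \<open>s = 1 / x \<rightarrow> 0\<close> shows that \<open>x^g / y\<close> tends to 0, so the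
  singularity at the centre is removable.\<close>

lemma infinity_coordinate_analytic:
  assumes "local_parametrisation f None \<gamma>"
  shows "(\<lambda>z. infinity_coordinate (\<gamma> z)) analytic_on {0}"
proof -
  obtain r where r: "r > 0" "\<And>z. z \<in> ball 0 r - {0} \<Longrightarrow> \<gamma> z \<in> Some ` affine_curve f"
    "(\<lambda>z. xcoord (\<gamma> z)) holomorphic_on ball 0 r - {0}"
    "(\<lambda>z. ycoord (\<gamma> z)) holomorphic_on ball 0 r - {0}"
    "filterlim (\<lambda>z. xcoord (\<gamma> z)) at_infinity (at 0)"
    by (rule local_parametrisation_infinity[OF assms]) (rule that; assumption)
  obtain M where M: "M > 0" "\<And>x. cmod x > M \<Longrightarrow> poly f x \<noteq> 0"
    using infinity_chart by metis
  define F where "F = reflect_poly f"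
  define w where "w = (\<lambda>z. infinity_coordinate (\<gamma> z))"
  have "\<forall>\<^sub>F z in at 0. M + 1 \<le> cmod (xcoord (\<gamma> z))"
    using r(5) M(1) by (auto simp: filterlim_at_infinity[of 0])
  then obtain d where d: "d > 0" "\<And>z. z \<noteq> 0 \<Longrightarrow> dist z 0 < d \<Longrightarrow> M + 1 \<le> cmod (xcoord (\<gamma> z))"
    unfolding eventually_at by auto
  define B where "B = ball (0::complex) (min r d)"
  have on: "\<gamma> z = Some (xcoord (\<gamma> z), ycoord (\<gamma> z))" "(ycoord (\<gamma> z))\<^sup>2 = poly f (xcoord (\<gamma> z))"
    "xcoord (\<gamma> z) \<noteq> 0" "ycoord (\<gamma> z) \<noteq> 0" if z: "z \<in> B - {0}" for z
  proof -
    obtain x y where xy: "\<gamma> z = Some (x, y)" "y\<^sup>2 = poly f x"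
      using r(2)[of z] z unfolding B_def by fastforce
    moreover have "M + 1 \<le> cmod (xcoord (\<gamma> z))" using d(2)[of z] that by (auto simp: B_def)
    then have "cmod x > M" by (simp add: xy xcoord_def)
    moreover have "poly f x \<noteq> 0" using M(2) \<open>cmod x > M\<close> by blast
    ultimately show "\<gamma> z = Some (xcoord (\<gamma> z), ycoord (\<gamma> z))"
      "(ycoord (\<gamma> z))\<^sup>2 = poly f (xcoord (\<gamma> z))"
      "xcoord (\<gamma> z) \<noteq> 0" "ycoord (\<gamma> z) \<noteq> 0"
      using M(1) by (auto simp: xcoord_def ycoord_def)
  qed
  have w: "w z = xcoord (\<gamma> z) ^ g / ycoord (\<gamma> z)" if "z \<in> B - {0}" for z
    unfolding w_def by (subst on(1)[OF that]) (simp add: infinity_coordinate_def)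
  have sub: "B - {0} \<subseteq> ball 0 r - {0}" by (auto simp: B_def)
  have "(\<lambda>z. xcoord (\<gamma> z) ^ g / ycoord (\<gamma> z)) holomorphic_on B - {0}"
    using on(4) holomorphic_on_subset[OF r(3) sub] holomorphic_on_subset[OF r(4) sub]
    by (intro holomorphic_intros) auto
  then have hol: "w holomorphic_on B - {0}"
    by (rule holomorphic_transform) (simp add: w)
  have "((\<lambda>z. inverse (xcoord (\<gamma> z))) \<longlongrightarrow> 0) (at 0)"
    using r(5) by (rule filterlim_compose[OF tendsto_inverse_0])
  then have "((\<lambda>z. inverse (xcoord (\<gamma> z)) / poly F (inverse (xcoord (\<gamma> z)))) \<longlongrightarrow> 0 / poly F 0) (at 0)"
    using f_nonzero by (intro tendsto_intros) (auto simp: F_def)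
  moreover have "\<forall>\<^sub>F z in at 0. (w z)\<^sup>2 = inverse (xcoord (\<gamma> z)) / poly F (inverse (xcoord (\<gamma> z)))"
  proof -
    have "\<forall>\<^sub>F z in at 0. z \<in> B - {0}"
      unfolding B_def using r(1) d(1) by (intro eventually_at_in_open) auto
    then show ?thesis
    proof eventually_elim
      case (elim z)
      let ?x = "xcoord (\<gamma> z)"
      have "(w z)\<^sup>2 = ?x ^ (2 * g) / poly f ?x"
        using on(2)[OF elim] by (simp add: w[OF elim] power_divide power_mult[symmetric] mult.commute)
      then show ?case
        using poly_f_reflect[OF on(3)[OF elim]] on(3)[OF elim]
        by (simp add: F_def field_simps)
    qed
  qed
  ultimately have "((\<lambda>z. (w z)\<^sup>2) \<longlongrightarrow> 0) (at 0)"
    using tendsto_cong by fastforce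
  then have "((\<lambda>z. sqrt (cmod ((w z)\<^sup>2))) \<longlongrightarrow> sqrt (cmod 0)) (at 0)"
    by (intro tendsto_intros)
  then have "(w \<longlongrightarrow> 0) (at 0)"
    by (simp add: norm_power tendsto_norm_zero_iff)
  moreover have "w 0 = 0"
    using assms by (simp add: w_def infinity_coordinate_def local_parametrisation_def)
  ultimately have "(w \<longlongrightarrow> w z) (at z within B)" if "z \<in> {0}" for z
    using that by (auto intro: tendsto_within_subset)
  then have "w holomorphic_on B"
    using hol by (rule no_isolated_singularity') (auto simp: B_def)
  then show ?thesis
    using r(1) d(1) unfolding w_def analytic_at B_def by (intro exI[of _ "ball 0 (min r d)"]) auto
qed

lemma infinity_parametrisation:
  defines "\<gamma> \<equiv> parametrisation_at f None"
  shows "local_parametrisation f None \<gamma>"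
    and "has_order (\<lambda>z. xcoord (\<gamma> z) ^ g / ycoord (\<gamma> z)) 1"
    and "meromorphic_at f h None \<Longrightarrow>
      \<exists>H M. H meromorphic_on {0} \<and>
        (\<forall>x y. y\<^sup>2 = poly f x \<longrightarrow> cmod x > M \<longrightarrow> h (Some (x, y)) = H (x ^ g / y))"
proof -
  obtain M \<gamma>\<^sub>0 where M: "M > 0" "local_parametrisation f None \<gamma>\<^sub>0"
    and "\<And>x. cmod x > M \<Longrightarrow> poly f x \<noteq> 0"
    and inv: "\<And>Q. Q = None \<or> Q \<in> Some ` {(x, y). (x, y) \<in> affine_curve f \<and> cmod x > M} \<Longrightarrow>
      \<gamma>\<^sub>0 (infinity_coordinate Q) = Q"
    by (rule infinity_chart) (rule that; assumption)
  have w0: "infinity_coordinate None = 0" by (simp add: infinity_coordinate_def)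
  define U where "U = insert None (Some ` {(x, y). (x, y) \<in> affine_curve f \<and> cmod x > M})"
  have U: "openin (curve f) U" "None \<in> U"
    unfolding U_def by (rule openin_curve_infinity) simp
  have inv': "\<gamma>\<^sub>0 (infinity_coordinate Q) = Q" if "Q \<in> U" for Q
    using inv[of Q] that unfolding U_def by simp
  note transfer = parametrisation_transfer[OF M(2) U inv' w0 infinity_coordinate_analytic,
      folded \<gamma>_def]
  show loc: "local_parametrisation f None \<gamma>"
    by (rule transfer(1))
  have ord: "has_order (\<lambda>z. infinity_coordinate (\<gamma> z)) 1"
    by (rule transfer(2))
  obtain r where r: "r > 0" "\<And>z. z \<in> ball 0 r - {0} \<Longrightarrow> \<gamma> z \<in> Some ` affine_curve f"
    using local_parametrisation_infinity[OF loc] by metis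
  have "\<forall>\<^sub>F z in at 0. z \<in> ball 0 r - {0}"
    using r(1) by (intro eventually_at_in_open) auto
  then have "\<forall>\<^sub>F z in at 0. infinity_coordinate (\<gamma> z) = xcoord (\<gamma> z) ^ g / ycoord (\<gamma> z)"
    by eventually_elim (use r(2) in \<open>force simp: infinity_coordinate_def xcoord_def ycoord_def\<close>)
  from has_order_cong[OF this] ord
  show "has_order (\<lambda>z. xcoord (\<gamma> z) ^ g / ycoord (\<gamma> z)) 1"
    by simp
  show "\<exists>H M. H meromorphic_on {0} \<and>
        (\<forall>x y. y\<^sup>2 = poly f x \<longrightarrow> cmod x > M \<longrightarrow> h (Some (x, y)) = H (x ^ g / y))"
    if "meromorphic_at f h None"
  proof (intro exI conjI allI impI)
    show "(\<lambda>t. h (\<gamma>\<^sub>0 t)) meromorphic_on {0}"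
      by (rule transfer(4)[OF _ _ that])
    show "h (Some (x, y)) = h (\<gamma>\<^sub>0 (x ^ g / y))" if "y\<^sup>2 = poly f x" "cmod x > M" for x y
      using inv[of "Some (x, y)"] that by (auto simp: infinity_coordinate_def)
  qed
qed

end

section \<open>Orders at the ramification points\<close>

lemma analytic_on_poly_compose:
  assumes "X analytic_on S"
  shows "(\<lambda>z. poly A (X z)) analytic_on S"
  by (induction A) (auto intro!: analytic_intros assms)

lemma has_order_poly:
  assumes "X analytic_on {0}" "X 0 = a" "has_order (\<lambda>z. X z - a) m" "A \<noteq> 0"
  shows "has_order (\<lambda>z. poly A (X z)) (int (order a A) * m)"
proof -
  obtain A' where A': "A = [:- a, 1:] ^ order a A * A'" "\<not> [:- a, 1:] dvd A'"
    using order_decomp[OF assms(4)] by blast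
  then have "poly A' (X 0) \<noteq> 0"
    using assms(2) by (simp add: poly_eq_0_iff_dvd)
  moreover have "(\<lambda>z. poly A' (X z)) analytic_on {0}"
    using assms(1) by (rule analytic_on_poly_compose)
  ultimately have "has_order (\<lambda>z. poly A' (X z)) 0"
    by (intro has_order_0I)
  from has_order_mult[OF has_order_power[OF assms(3)] this]
  have "has_order (\<lambda>z. (X z - a) ^ order a A * poly A' (X z)) (int (order a A) * m + 0)" .
  moreover have "poly A (X z) = (X z - a) ^ order a A * poly A' (X z)" for z
    by (subst A'(1)) (simp add: poly_power)
  ultimately show ?thesis by simp
qed

lemma has_order_poly_pole:
  assumes "has_order X m" "m < 0" "A \<noteq> 0"
  shows "has_order (\<lambda>z. poly A (X z)) (int (degree A) * m)"
  using \<open>A \<noteq> 0\<close>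
proof (induction A)
  case (pCons c A)
  show ?case
  proof (cases "A = 0")
    case True
    then show ?thesis using pCons.hyps by (auto intro!: has_order_0I)
  next
    case False
    from has_order_mult[OF assms(1) pCons.IH[OF False]]
    have XA: "has_order (\<lambda>z. X z * poly A (X z)) (int (degree (pCons c A)) * m)"
      using False by (simp add: algebra_simps)
    show ?thesis
    proof (cases "c = 0")
      case True
      then show ?thesis using XA by simp
    next
      case c: False
      let ?m = "int (degree (pCons c A)) * m"
      have "?m < 0"
        using False assms(2) by (simp add: mult_pos_neg)
      then have "0 \<noteq> ?m" "min 0 ?m = ?m" by linarith+
      moreover have "has_order (\<lambda>z. c) 0" using c by (intro has_order_0I) auto
      ultimately have "has_order (\<lambda>z. c + X z * poly A (X z)) ?m"
        using has_order_add[OF _ XA, of "\<lambda>z. c" 0] by (simp only: simp_thms)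
      then show ?thesis by (simp only: poly_pCons)
    qed
  qed
qed simp

text \<open>Orders of different parity cannot cancel. Both kinds of ramification point are instances.\<close>

lemma has_order_even_odd:
  assumes "A \<noteq> 0 \<Longrightarrow> has_order (\<lambda>z. poly A (X z)) (2 * i)"
    and "B \<noteq> 0 \<Longrightarrow> has_order (\<lambda>z. poly B (X z) * Y z) (2 * j + 1)"
    and "A \<noteq> 0 \<or> B \<noteq> 0"
  shows "has_order (\<lambda>z. poly A (X z) + poly B (X z) * Y z)
           (if B = 0 then 2 * i else if A = 0 then 2 * j + 1 else min (2 * i) (2 * j + 1))"
proof -
  have "2 * i \<noteq> 2 * j + 1" by presburger
  then show ?thesis
    using assms has_order_add[of "\<lambda>z. poly A (X z)" "2 * i" "\<lambda>z. poly B (X z) * Y z" "2 * j + 1"]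
    by auto
qed

context odd_hyperelliptic
begin

lemma affine_parametrisation:
  assumes "(a, b) \<in> affine_curve f"
  defines "\<gamma> \<equiv> parametrisation_at f (Some (a, b))"
  shows "\<gamma> 0 = Some (a, b)"
    and "(\<lambda>z. xcoord (\<gamma> z)) analytic_on {0}" "(\<lambda>z. ycoord (\<gamma> z)) analytic_on {0}"
    and "\<forall>\<^sub>F z in nhds 0. \<gamma> z \<in> Some ` affine_curve f"
proof -
  have "local_parametrisation f (Some (a, b)) \<gamma>"
    using branch_point_parametrisation(1)[of a] regular_point_parametrisation(1)[of b a] assms
    by (cases "b = 0") auto
  note loc = this local_parametrisation_analytic[OF this assms(1)]
  show "\<gamma> 0 = Some (a, b)" using loc(1) by (simp add: local_parametrisation_def)
  show "(\<lambda>z. xcoord (\<gamma> z)) analytic_on {0}" "(\<lambda>z. ycoord (\<gamma> z)) analytic_on {0}"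
    "\<forall>\<^sub>F z in nhds 0. \<gamma> z \<in> Some ` affine_curve f"
    using loc by blast+
qed

text \<open>Solve \<open>y\<^sup>2 = (x - a) f\<^sub>1(x)\<close> for \<open>x - a\<close>, where \<open>f\<^sub>1(a) \<noteq> 0\<close> because the root is simple.\<close>

lemma has_order_x_branch_point:
  assumes "poly f a = 0"
  shows "has_order (\<lambda>z. xcoord (parametrisation_at f (Some (a, 0)) z) - a) 2"
proof -
  define \<gamma> where "\<gamma> = parametrisation_at f (Some (a, 0))"
  have mem: "(a, 0) \<in> affine_curve f" using assms by simp
  note \<gamma> = affine_parametrisation[OF mem, folded \<gamma>_def]
  have Y: "has_order (\<lambda>z. ycoord (\<gamma> z)) 1"
    using branch_point_parametrisation(2)[OF assms] by (simp add: \<gamma>_def)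
  obtain f\<^sub>1 where f: "f = [:- a, 1:] * f\<^sub>1"
    using assms by (auto simp: poly_eq_0_iff_dvd elim: dvdE)
  have "poly f\<^sub>1 a \<noteq> 0"
    using simple_roots[OF assms] unfolding f pderiv_mult by (simp add: pderiv_pCons)
  then have "has_order (\<lambda>z. poly f\<^sub>1 (xcoord (\<gamma> z))) 0"
    using \<gamma>(1) by (intro has_order_0I analytic_on_poly_compose \<gamma>(2)) (simp add: xcoord_def)
  note 0 = this
  have "\<forall>\<^sub>F z in at 0. \<gamma> z \<in> Some ` affine_curve f"
    by (rule filter_leD[OF at_within_le_nhds \<gamma>(4)])
  then have "\<forall>\<^sub>F z in at 0. ycoord (\<gamma> z) ^ 2 / poly f\<^sub>1 (xcoord (\<gamma> z)) = xcoord (\<gamma> z) - a"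
    using has_orderD(2)[OF 0]
  proof eventually_elim
    case (elim z)
    then obtain x y where xy: "\<gamma> z = Some (x, y)" "y\<^sup>2 = poly f x" by auto
    have "y\<^sup>2 = (x - a) * poly f\<^sub>1 x" unfolding xy(2) by (simp add: f algebra_simps)
    then show ?case using elim(2) by (simp add: xy(1) xcoord_def ycoord_def)
  qed
  from has_order_cong[OF this] has_order_divide[OF has_order_power[OF Y, of 2] 0]
  show ?thesis by (simp add: \<gamma>_def)
qed

text \<open>With \<open>w = x^g / y\<close> of order 1, \<open>x = 1 / (w\<^sup>2 F(1 / x))\<close> has order \<open>-2\<close> and \<open>y = x^g / w\<close> has
  order \<open>-2 g - 1\<close>.\<close>

lemma has_order_x_infinity:
  shows "has_order (\<lambda>z. xcoord (parametrisation_at f None z)) (-2)" (is ?X)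
    and "has_order (\<lambda>z. ycoord (parametrisation_at f None z)) (- 2 * int g - 1)" (is ?Y)
proof -
  define \<gamma> where "\<gamma> = parametrisation_at f None"
  define F where "F = reflect_poly f"
  have w: "has_order (\<lambda>z. xcoord (\<gamma> z) ^ g / ycoord (\<gamma> z)) 1"
    using infinity_parametrisation(2) by (simp add: \<gamma>_def)
  have "local_parametrisation f None \<gamma>"
    using infinity_parametrisation(1) by (simp add: \<gamma>_def)
  then obtain r where r: "r > 0" "\<And>z. z \<in> ball 0 r - {0} \<Longrightarrow> \<gamma> z \<in> Some ` affine_curve f"
    "(\<lambda>z. xcoord (\<gamma> z)) holomorphic_on ball 0 r - {0}"
    "(\<lambda>z. ycoord (\<gamma> z)) holomorphic_on ball 0 r - {0}"
    "filterlim (\<lambda>z. xcoord (\<gamma> z)) at_infinity (at 0)"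
    by (rule local_parametrisation_infinity) (rule that; assumption)
  have ev: "\<forall>\<^sub>F z in at 0. z \<in> ball 0 r - {0}"
    using r(1) by (intro eventually_at_in_open) auto
  define s where "s = (\<lambda>z. if z = 0 then 0 else inverse (xcoord (\<gamma> z)))"
  have lim: "((\<lambda>z. inverse (xcoord (\<gamma> z))) \<longlongrightarrow> 0) (at 0)"
    using r(5) by (rule filterlim_compose[OF tendsto_inverse_0])
  have nz: "\<forall>\<^sub>F z in at 0. xcoord (\<gamma> z) \<noteq> 0"
    using filterlim_at_infinity_imp_eventually_ne[OF r(5)] .
  have X_mero: "(\<lambda>z. xcoord (\<gamma> z)) meromorphic_on {0}"
  proof -
    have "isolated_singularity_at (\<lambda>z. xcoord (\<gamma> z)) 0"
      using r(1,3) by (intro isolated_singularity_at_holomorphic[of _ "ball 0 r"]) auto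
    moreover have "not_essential (\<lambda>z. xcoord (\<gamma> z)) 0"
      using r(5) by (simp add: not_essential_def is_pole_def)
    ultimately show ?thesis by (simp add: meromorphic_at_iff)
  qed
  have "s meromorphic_on {0}"
  proof -
    have "(\<lambda>z. inverse (xcoord (\<gamma> z))) meromorphic_on {0}"
      using X_mero by (intro meromorphic_intros)
    moreover have "\<forall>\<^sub>F z in at 0. s z = inverse (xcoord (\<gamma> z))"
      by (auto simp: s_def eventually_at_filter)
    ultimately show ?thesis
      by (subst meromorphic_on_cong[where g = "\<lambda>z. inverse (xcoord (\<gamma> z))"]) auto
  qed
  moreover have "isCont s 0"
    unfolding isCont_def
    by (rule Lim_transform_eventually[of "\<lambda>z. inverse (xcoord (\<gamma> z))"])
       (use lim in \<open>auto simp: s_def eventually_at_filter\<close>)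
  ultimately have s: "s analytic_on {0}"
    by (intro meromorphic_at_isCont_imp_analytic)
  have "has_order (\<lambda>z. poly F (s z)) 0"
    using f_nonzero by (intro has_order_0I analytic_on_poly_compose s) (simp add: s_def F_def)
  note F = this
  have ord: "has_order (\<lambda>z. 1 / ((xcoord (\<gamma> z) ^ g / ycoord (\<gamma> z)) ^ 2 * poly F (s z))) (0 - (int 2 * 1 + 0))"
    by (intro has_order_divide[OF _ has_order_mult[OF has_order_power[OF w] F]] has_order_0I) auto
  have "\<forall>\<^sub>F z in at 0. 1 / ((xcoord (\<gamma> z) ^ g / ycoord (\<gamma> z)) ^ 2 * poly F (s z)) = xcoord (\<gamma> z)"
    using ev nz has_orderD(2)[OF ord]
  proof eventually_elim
    case (elim z)
    then obtain x y where xy: "\<gamma> z = Some (x, y)" "y\<^sup>2 = poly f x"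
      using r(2)[of z] by auto
    have x: "x \<noteq> 0" using elim(2) by (simp add: xy xcoord_def)
    have F: "poly F (s z) \<noteq> 0" using elim(3) by auto
    have "s z = 1 / x" using elim(1) by (simp add: s_def xy xcoord_def inverse_eq_divide)
    moreover have "(x ^ g / y) ^ 2 = x ^ (2 * g) / poly f x"
      by (simp add: power_divide power_mult[symmetric] mult.commute xy(2))
    ultimately show ?case
      using x F poly_f_reflect[OF x] by (simp add: xy xcoord_def ycoord_def F_def)
  qed
  from has_order_cong[OF this] ord have X: "has_order (\<lambda>z. xcoord (\<gamma> z)) (-2)" by simp
  have ord': "has_order (\<lambda>z. xcoord (\<gamma> z) ^ g / (xcoord (\<gamma> z) ^ g / ycoord (\<gamma> z))) (int g * (-2) - 1)"
    by (intro has_order_divide has_order_power X w)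
  have "\<forall>\<^sub>F z in at 0. xcoord (\<gamma> z) ^ g / (xcoord (\<gamma> z) ^ g / ycoord (\<gamma> z)) = ycoord (\<gamma> z)"
    using nz by eventually_elim simp
  from has_order_cong[OF this] ord' have Y: "has_order (\<lambda>z. ycoord (\<gamma> z)) (- 2 * int g - 1)"
    by (simp add: mult.commute)
  from X Y show ?X ?Y by (simp_all add: \<gamma>_def)
qed

text \<open>The function \<open>A(x) + B(x) y\<close>, extended by 0 as in the representation of sections.\<close>

definition curve_function :: "complex poly \<Rightarrow> complex poly \<Rightarrow> point \<Rightarrow> complex" where
  "curve_function A B Q = (case Q of None \<Rightarrow> 0
     | Some (x, y) \<Rightarrow> if (x, y) \<in> affine_curve f then poly A x + poly B x * y else 0)"

lemma curve_function_on_curve: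
  assumes "Q \<in> Some ` affine_curve f"
  shows "curve_function A B Q = poly A (xcoord Q) + poly B (xcoord Q) * ycoord Q"
  using assms by (auto simp: curve_function_def xcoord_def ycoord_def)

lemma curve_function_order_branch_point:
  assumes "poly f a = 0" "A \<noteq> 0 \<or> B \<noteq> 0"
  shows "has_order (\<lambda>z. curve_function A B (parametrisation_at f (Some (a, 0)) z))
    (if B = 0 then 2 * int (order a A) else if A = 0 then 2 * int (order a B) + 1
     else min (2 * int (order a A)) (2 * int (order a B) + 1))"
proof -
  define \<gamma> where "\<gamma> = parametrisation_at f (Some (a, 0))"
  have mem: "(a, 0) \<in> affine_curve f" using assms by simp
  note \<gamma> = affine_parametrisation[OF mem, folded \<gamma>_def]
  have X: "has_order (\<lambda>z. xcoord (\<gamma> z) - a) 2"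
    using has_order_x_branch_point[OF assms(1)] by (simp add: \<gamma>_def)
  have Y: "has_order (\<lambda>z. ycoord (\<gamma> z)) 1"
    using branch_point_parametrisation(2)[OF assms(1)] by (simp add: \<gamma>_def)
  have X0: "xcoord (\<gamma> 0) = a" by (simp add: \<gamma>(1) xcoord_def)
  have poly: "has_order (\<lambda>z. poly A (xcoord (\<gamma> z))) (2 * int (order a A))" if "A \<noteq> 0" for A
    using has_order_poly[OF \<gamma>(2) X0 X that] by (simp add: mult.commute)
  have "\<forall>\<^sub>F z in at 0. \<gamma> z \<in> Some ` affine_curve f"
    by (rule filter_leD[OF at_within_le_nhds \<gamma>(4)])
  then have "\<forall>\<^sub>F z in at 0. curve_function A B (\<gamma> z)
      = poly A (xcoord (\<gamma> z)) + poly B (xcoord (\<gamma> z)) * ycoord (\<gamma> z)"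
    by eventually_elim (rule curve_function_on_curve)
  from has_order_cong[OF this] show ?thesis
    using has_order_even_odd[of A "\<lambda>z. xcoord (\<gamma> z)" "int (order a A)" B "\<lambda>z. ycoord (\<gamma> z)"
        "int (order a B)"] poly has_order_mult[OF poly Y] assms(2)
    by (simp add: \<gamma>_def)
qed

lemma curve_function_order_infinity:
  assumes "A \<noteq> 0 \<or> B \<noteq> 0"
  shows "has_order (\<lambda>z. curve_function A B (parametrisation_at f None z))
    (if B = 0 then - 2 * int (degree A) else if A = 0 then - 2 * int (degree B + g) - 1
     else min (- 2 * int (degree A)) (- 2 * int (degree B + g) - 1))"
proof -
  define \<gamma> where "\<gamma> = parametrisation_at f None"
  have X: "has_order (\<lambda>z. xcoord (\<gamma> z)) (-2)" and Y: "has_order (\<lambda>z. ycoord (\<gamma> z)) (- 2 * int g - 1)"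
    using has_order_x_infinity by (simp_all add: \<gamma>_def)
  have poly: "has_order (\<lambda>z. poly A (xcoord (\<gamma> z))) (2 * - int (degree A))" if "A \<noteq> 0" for A
    using has_order_poly_pole[OF X _ that] by (simp add: mult.commute)
  have "local_parametrisation f None \<gamma>"
    using infinity_parametrisation(1) by (simp add: \<gamma>_def)
  then obtain r where r: "r > 0" "\<And>z. z \<in> ball 0 r - {0} \<Longrightarrow> \<gamma> z \<in> Some ` affine_curve f"
    using local_parametrisation_infinity by metis
  have "\<forall>\<^sub>F z in at 0. z \<in> ball 0 r - {0}"
    using r(1) by (intro eventually_at_in_open) auto
  then have "\<forall>\<^sub>F z in at 0. curve_function A B (\<gamma> z)
      = poly A (xcoord (\<gamma> z)) + poly B (xcoord (\<gamma> z)) * ycoord (\<gamma> z)"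
    by eventually_elim (intro curve_function_on_curve r(2))
  note cong = has_order_cong[OF this]
  have "has_order (\<lambda>z. poly B (xcoord (\<gamma> z)) * ycoord (\<gamma> z)) (2 * (- int (degree B + g) - 1) + 1)"
    if "B \<noteq> 0"
  proof -
    have "2 * - int (degree B) + (- 2 * int g - 1) = 2 * (- int (degree B + g) - 1) + 1"
      by simp
    with has_order_mult[OF poly[OF that] Y] show ?thesis by metis
  qed
  note order = has_order_even_odd[OF poly this assms]
  have "2 * - int (degree A) = - 2 * int (degree A)"
    "2 * (- int (degree B + g) - 1) + 1 = - 2 * int (degree B + g) - 1"
    by simp_all
  then show ?thesis
    using order unfolding cong[unfolded \<gamma>_def] \<gamma>_def by metis
qed

lemma ramification_index_branch_point:
  assumes "poly f a = 0"
  shows "ramification_index f (Some (a, 0)) = 2"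
  using has_orderD(4)[OF has_order_x_branch_point[OF assms]]
  by (simp add: ramification_index_def ord_at_def o_def)

lemma ramification_index_regular_point:
  assumes "b\<^sup>2 = poly f a" "b \<noteq> 0"
  shows "ramification_index f (Some (a, b)) = 1"
  using has_orderD(4)[OF regular_point_parametrisation(2)[OF assms]]
  by (simp add: ramification_index_def ord_at_def o_def)

lemma ramification_index_infinity: "ramification_index f None = 2"
proof -
  have "has_order (\<lambda>z. 1 / xcoord (parametrisation_at f None z)) (0 - (-2))"
    by (intro has_order_divide has_order_x_infinity has_order_0I) auto
  from has_orderD(4)[OF this] show ?thesis
    by (simp add: ramification_index_def ord_at_def o_def)
qed

end

section \<open>Meromorphic functions with poles only at infinity\<close>

lemma meromorphic_growth:
  assumes "H meromorphic_on {0}"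
  obtains N C d where "d > 0" "C \<ge> 0"
    "\<And>w. w \<noteq> 0 \<Longrightarrow> cmod w < d \<Longrightarrow> cmod (H w) * cmod w ^ N \<le> C"
proof -
  obtain L where L: "H has_laurent_expansion L"
    using assms by (auto simp: meromorphic_on_def)
  define N where "N = nat (- fls_subdegree L)"
  have "(\<lambda>w. H w * w ^ N) has_laurent_expansion L * fls_X ^ N"
    by (intro laurent_expansion_intros L)
  moreover have "fls_subdegree (L * fls_X ^ N) \<ge> 0"
    by (cases "L = 0") (auto simp: N_def)
  ultimately obtain l where "((\<lambda>w. H w * w ^ N) \<longlongrightarrow> l) (at 0)"
    using has_laurent_expansion_imp_tendsto_0 by blast
  then have "((\<lambda>w. cmod (H w * w ^ N)) \<longlongrightarrow> cmod l) (at 0)"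
    by (rule tendsto_norm)
  then have "\<forall>\<^sub>F w in at 0. cmod (H w * w ^ N) < cmod l + 1"
    by (rule order_tendstoD) simp
  then obtain d where "d > 0" "\<And>w. w \<noteq> 0 \<Longrightarrow> dist w 0 < d \<Longrightarrow> cmod (H w * w ^ N) < cmod l + 1"
    unfolding eventually_at by auto
  then show ?thesis
    by (intro that[of d "cmod l + 1" N]) (auto simp: norm_mult norm_power less_imp_le)
qed

lemma entire_polynomial_growth:
  assumes "\<tau> holomorphic_on UNIV" "\<And>x. A \<le> cmod x \<Longrightarrow> cmod (\<tau> x) \<le> B * cmod x ^ n"
  obtains T where "\<And>x. \<tau> x = poly T x"
proof
  show "\<tau> x = poly (\<Sum>k\<le>n. monom ((deriv ^^ k) \<tau> 0 / fact k) k) x" for x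
    using Liouville_polynomial[OF assms] by (simp add: poly_sum poly_monom)
qed

lemma Re_csqrt_pos:
  assumes "Re z > 0"
  shows "Re (csqrt z) > 0"
proof (rule ccontr)
  assume "\<not> ?thesis"
  then have "Re (csqrt z) = 0" using csqrt_principal[of z] by auto
  then have "Re ((csqrt z)\<^sup>2) \<le> 0" by (simp add: power2_eq_square)
  then show False using assms by simp
qed

context odd_hyperelliptic
begin

text \<open>Since \<open>f\<close> has as many roots as its degree, the remainder of \<open>p\<close> modulo \<open>f\<close> has too many.\<close>

lemma dvd_of_vanishing_at_roots:
  assumes "\<And>a. poly f a = 0 \<Longrightarrow> poly p a = 0"
  shows "f dvd p"
proof (rule ccontr)
  assume "\<not> f dvd p"
  then have r: "p mod f \<noteq> 0" by (simp add: dvd_eq_mod_eq_0)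
  have "rsquarefree f"
    using simple_roots by (auto simp: rsquarefree_roots)
  from complex_poly_decompose_rsquarefree[OF this]
  have "degree f = degree (\<Prod>z | poly f z = 0. [:- z, 1:])"
    using f_nonzero by (metis degree_smult_eq leading_coeff_0_iff)
  also have "\<dots> = card {z. poly f z = 0}"
    by (subst degree_prod_sum_eq) auto
  finally have "degree f = card {z. poly f z = 0}" .
  also have "\<dots> \<le> card {z. poly (p mod f) z = 0}"
  proof (intro card_mono subsetI)
    show "finite {z. poly (p mod f) z = 0}" using r by (rule poly_roots_finite)
    show "z \<in> {z. poly (p mod f) z = 0}" if "z \<in> {z. poly f z = 0}" for z
    proof -
      have "poly p z = poly (p div f * f + p mod f) z" by simp
      then show ?thesis using that assms[of z] unfolding poly_add poly_mult by simp
    qed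
  qed
  also have "\<dots> \<le> degree (p mod f)" using r by (rule card_poly_roots_bound)
  also have "\<dots> < degree f"
    using degree_mod_less[OF f_nonzero, of p] r by simp
  finally show False by simp
qed

text \<open>Near \<open>a\<close> the two points over \<open>x\<close> lie in the two charts given by \<open>x - a\<close> at \<open>(a, b)\<close> and
  \<open>(a, -b)\<close>.\<close>

lemma trace_analytic_regular_point:
  assumes hol: "\<And>p. p \<in> affine_curve f \<Longrightarrow> holomorphic_at f h (Some p)"
    and trace: "\<And>x y. y\<^sup>2 = poly f x \<Longrightarrow> h (Some (x, y)) + h (Some (x, - y)) = \<tau> x"
    and "poly f a \<noteq> 0"
  shows "\<tau> analytic_on {a}"
proof -
  define b where "b = csqrt (poly f a)"
  have b: "b\<^sup>2 = poly f a" "b \<noteq> 0" using assms(3) by (auto simp: b_def)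
  obtain H\<^sub>1 where H\<^sub>1: "H\<^sub>1 analytic_on {0}"
    "\<And>x y. y\<^sup>2 = poly f x \<Longrightarrow> Re (y / b) > 0 \<Longrightarrow> h (Some (x, y)) = H\<^sub>1 (x - a)"
    using regular_point_parametrisation(3)[OF b, of h] hol[of "(a, b)"] b by auto
  obtain H\<^sub>2 where H\<^sub>2: "H\<^sub>2 analytic_on {0}"
    "\<And>x y. y\<^sup>2 = poly f x \<Longrightarrow> Re (y / - b) > 0 \<Longrightarrow> h (Some (x, y)) = H\<^sub>2 (x - a)"
    using regular_point_parametrisation(3)[of "- b" a h] hol[of "(a, - b)"] b by auto
  have "((\<lambda>x. Re (poly f x / b\<^sup>2)) \<longlongrightarrow> Re (poly f a / b\<^sup>2)) (at a)"
    using b(2) by (intro tendsto_intros isContD[of a "poly f"] poly_isCont) simp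
  then have "((\<lambda>x. Re (poly f x / b\<^sup>2)) \<longlongrightarrow> Re (poly f a / b\<^sup>2)) (nhds a)"
    using tendsto_at_iff_tendsto_nhds[of "\<lambda>x. Re (poly f x / b\<^sup>2)" a] by metis
  moreover have "Re (poly f a / b\<^sup>2) > 0" using b(2) by (simp add: b(1)[symmetric])
  ultimately have "\<forall>\<^sub>F x in nhds a. Re (poly f x / b\<^sup>2) > 0"
    by (rule order_tendstoD(1))
  then have ev: "\<forall>\<^sub>F x in nhds a. \<tau> x = H\<^sub>1 (x - a) + H\<^sub>2 (x - a)"
  proof eventually_elim
    case (elim x)
    \<comment> \<open>the square root of \<open>f(x)\<close> near \<open>b\<close>; \<open>csqrt (poly f x)\<close> itself may jump to the branch near \<open>-b\<close>\<close>
    define y where "y = b * csqrt (poly f x / b\<^sup>2)"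
    have y: "y\<^sup>2 = poly f x" "(- y)\<^sup>2 = poly f x"
      using b(2) by (simp_all add: y_def power_mult_distrib)
    have "Re (y / b) > 0" using Re_csqrt_pos[OF elim] b(2) by (simp add: y_def)
    then show ?case
      using trace[OF y(1)] H\<^sub>1(2)[OF y(1)] H\<^sub>2(2)[OF y(2)] by simp
  qed
  have "(H \<circ> (\<lambda>x. x - a)) analytic_on {a}" if "H analytic_on {0}" for H :: "complex \<Rightarrow> complex"
    using that by (intro analytic_on_compose analytic_intros) auto
  from this[OF H\<^sub>1(1)] this[OF H\<^sub>2(1)]
  have "(\<lambda>x. H\<^sub>1 (x - a) + H\<^sub>2 (x - a)) analytic_on {a}"
    unfolding o_def by (rule analytic_on_add)
  then show ?thesis using analytic_at_cong[OF ev refl] by simp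
qed

text \<open>The two points over \<open>x\<close> have coordinates \<open>y\<close> and \<open>-y\<close> with \<open>y\<^sup>2 = f(x) \<rightarrow> 0\<close>. Continuity is
  enough, because it makes the isolated singularity of the trace at \<open>a\<close> removable.\<close>

lemma trace_continuous_branch_point:
  assumes hol: "\<And>p. p \<in> affine_curve f \<Longrightarrow> holomorphic_at f h (Some p)"
    and trace: "\<And>x y. y\<^sup>2 = poly f x \<Longrightarrow> h (Some (x, y)) + h (Some (x, - y)) = \<tau> x"
    and "poly f a = 0"
  shows "isCont \<tau> a"
proof -
  obtain H V where H: "H analytic_on {0}" "open V" "a \<in> V"
    "\<And>x y. x \<in> V \<Longrightarrow> y\<^sup>2 = poly f x \<Longrightarrow> h (Some (x, y)) = H y"
    using branch_point_parametrisation(3)[OF assms(3), of h] hol[of "(a, 0)"] assms(3) by auto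
  define y where "y = (\<lambda>x. csqrt (poly f x))"
  have eq: "\<tau> x = H (y x) + H (- y x)" if "x \<in> V" for x
    using trace[of "y x" x] H(4)[OF that, of "y x"] H(4)[OF that, of "- y x"] by (simp add: y_def)
  have "((\<lambda>x. sqrt (cmod (poly f x))) \<longlongrightarrow> sqrt (cmod (poly f a))) (at a)"
    by (intro tendsto_intros isContD[of a "poly f"] poly_isCont)
  moreover have "sqrt (cmod (poly f x)) = cmod (y x)" for x
    by (metis norm_power power2_csqrt real_sqrt_unique norm_ge_zero y_def)
  ultimately have y: "(y \<longlongrightarrow> 0) (at a)"
    using assms(3) by (simp add: tendsto_norm_zero_iff)
  have "isCont H 0" using H(1) by (rule analytic_at_imp_isCont)
  then have "((\<lambda>x. H (y x) + H (- y x)) \<longlongrightarrow> H 0 + H (- 0)) (at a)"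
    using y by (intro tendsto_add isCont_tendsto_compose[of _ H] tendsto_minus) auto
  moreover have "\<tau> a = H 0 + H (- 0)" using eq[OF H(3)] by (simp add: y_def assms(3))
  moreover have "\<forall>\<^sub>F x in at a. \<tau> x = H (y x) + H (- y x)"
    using eventually_at_topological eq H(2,3) by blast
  ultimately show ?thesis
    unfolding isCont_def by (simp add: tendsto_cong)
qed

text \<open>Quantitatively \<open>w\<^sup>2 = s / F(s)\<close> says that \<open>x w\<^sup>2\<close> is bounded above and below near infinity.
  The lower bound turns a bound in powers of \<open>1 / w\<close> into one in powers of \<open>x\<close>.\<close>

lemma infinity_coordinate_estimate:
  assumes "d > 0"
  obtains M K where "K \<ge> 0"
    "\<And>x y. y\<^sup>2 = poly f x \<Longrightarrow> M \<le> cmod x \<Longrightarrow>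
       x ^ g / y \<noteq> 0 \<and> cmod (x ^ g / y) < d \<and> cmod (x ^ g / y) \<le> 1 \<and>
       1 \<le> K * cmod x * cmod (x ^ g / y) ^ 2"
proof -
  define F where "F = reflect_poly f"
  define c where "c = cmod (poly F 0)"
  have c: "c > 0" using f_nonzero by (simp add: c_def F_def)
  have "((\<lambda>x. cmod (poly F (inverse x))) \<longlongrightarrow> c) at_infinity"
    unfolding c_def by (intro tendsto_norm isCont_tendsto_compose[of _ "poly F"] tendsto_inverse_0)
      simp
  then have "\<forall>\<^sub>F x in at_infinity. c / 2 < cmod (poly F (inverse x)) \<and> cmod (poly F (inverse x)) < 2 * c"
    using c by (intro eventually_conj order_tendstoD) auto
  then obtain M where M: "\<And>x. M \<le> cmod x \<Longrightarrow>
      c / 2 < cmod (poly F (inverse x)) \<and> cmod (poly F (inverse x)) < 2 * c"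
    unfolding eventually_at_infinity by auto
  \<comment> \<open>beyond \<open>2 / (c e\<^sup>2)\<close> the upper bound \<open>2 / (c \<bar>x\<bar>)\<close> for the square of the coordinate is below \<open>e\<^sup>2\<close>\<close>
  define e where "e = min d 1"
  have e: "e > 0" "e \<le> d" "e \<le> 1" using assms by (auto simp: e_def)
  define M' where "M' = max M (2 / (c * e\<^sup>2) + 1)"
  show ?thesis
  proof (rule that[of "2 * c" M'])
    show "2 * c \<ge> 0" using c by simp
    fix x y assume xy: "y\<^sup>2 = poly f x" "M' \<le> cmod x"
    let ?w = "x ^ g / y" and ?F = "poly F (inverse x)"
    have F: "c / 2 < cmod ?F" "cmod ?F < 2 * c" using M[of x] xy(2) by (auto simp: M'_def)
    have "2 / (c * e\<^sup>2) > 0" using c e by simp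
    moreover have x: "2 / (c * e\<^sup>2) < cmod x" using xy(2) by (simp add: M'_def)
    ultimately have x0: "x \<noteq> 0" using zero_less_norm_iff[of x] by linarith
    have F0: "?F \<noteq> 0" using F(1) c by auto
    have fx: "poly f x = x ^ (2 * g) * (x * ?F)"
      using poly_f_reflect[OF x0] by (simp add: F_def inverse_eq_divide)
    have "?w ^ 2 = x ^ (2 * g) / poly f x"
      by (simp add: power_divide power_mult[symmetric] mult.commute xy(1))
    also have "\<dots> = 1 / (x * ?F)" using x0 F0 by (simp add: fx)
    finally have w: "cmod ?w ^ 2 = 1 / (cmod x * cmod ?F)"
      by (metis norm_divide norm_mult norm_one norm_power)
    have pos: "cmod x * cmod ?F > 0" using x0 F0 by simp
    have "y \<noteq> 0" using xy(1) fx x0 F0 by auto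
    then have "?w \<noteq> 0" using x0 by simp
    moreover have "cmod ?w < e"
    proof -
      have "2 < cmod x * (c * e\<^sup>2)" using x c e by (simp add: field_simps)
      also have "\<dots> = 2 * (cmod x * (c / 2) * e\<^sup>2)" by simp
      also have "\<dots> \<le> 2 * (cmod x * cmod ?F * e\<^sup>2)"
        using F(1) by (intro mult_left_mono mult_right_mono) auto
      finally have "1 < e\<^sup>2 * (cmod x * cmod ?F)" by (simp add: mult.commute)
      then have "cmod ?w ^ 2 < e ^ 2" using pos by (simp add: w field_simps)
      then show ?thesis using e(1) by (simp add: power2_less_imp_less)
    qed
    moreover have "1 \<le> 2 * c * cmod x * cmod ?w ^ 2"
    proof -
      have "cmod x * cmod ?F \<le> cmod x * (2 * c)" using F(2) by (intro mult_left_mono) auto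
      then have "1 \<le> 2 * c * cmod x / (cmod x * cmod ?F)"
        by (subst pos_le_divide_eq[OF pos]) (simp add: mult_ac)
      then show ?thesis by (simp only: w times_divide_eq_right mult_1_right)
    qed
    ultimately show "?w \<noteq> 0 \<and> cmod ?w < d \<and> cmod ?w \<le> 1 \<and> 1 \<le> 2 * c * cmod x * cmod ?w ^ 2"
      using e by linarith
  qed
qed

text \<open>The trace does not depend on the choice of square root, so it is a function of \<open>x\<close> alone. It
  is entire by the two preceding local statements and grows at most polynomially because \<open>h\<close> has
  at most a pole at infinity; Liouville's theorem applies.\<close>

lemma trace_polynomial:
  assumes hol: "\<And>p. p \<in> affine_curve f \<Longrightarrow> holomorphic_at f h (Some p)"
    and mero: "meromorphic_at f h None"
  obtains T where "\<And>x y. y\<^sup>2 = poly f x \<Longrightarrow> h (Some (x, y)) + h (Some (x, - y)) = poly T x"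
proof -
  define \<tau> where "\<tau> = (\<lambda>x. h (Some (x, csqrt (poly f x))) + h (Some (x, - csqrt (poly f x))))"
  have trace: "h (Some (x, y)) + h (Some (x, - y)) = \<tau> x" if "y\<^sup>2 = poly f x" for x y
  proof -
    have "y\<^sup>2 = (csqrt (poly f x))\<^sup>2" using that by simp
    then have "y = csqrt (poly f x) \<or> y = - csqrt (poly f x)" unfolding power2_eq_iff .
    then show ?thesis unfolding \<tau>_def by (metis add.commute minus_minus)
  qed
  have analytic: "\<tau> analytic_on {a}" if "poly f a \<noteq> 0" for a
    using hol trace that by (rule trace_analytic_regular_point)
  have "isCont \<tau> a" for a
    using trace_continuous_branch_point[OF hol trace, of a] analytic[of a]
      analytic_at_imp_isCont by blast
  then have "continuous_on UNIV \<tau>" by (simp add: continuous_at_imp_continuous_on)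
  moreover have "\<tau> analytic_on (UNIV - {a. poly f a = 0})"
    using analytic analytic_on_analytic_at by blast
  then have "\<tau> holomorphic_on (UNIV - {a. poly f a = 0})"
    by (rule analytic_imp_holomorphic)
  ultimately have entire: "\<tau> holomorphic_on UNIV"
    by (rule no_isolated_singularity) (auto intro: poly_roots_finite[OF f_nonzero])
  obtain H M where H: "H meromorphic_on {0}"
    "\<And>x y. y\<^sup>2 = poly f x \<Longrightarrow> cmod x > M \<Longrightarrow> h (Some (x, y)) = H (x ^ g / y)"
    using infinity_parametrisation(3)[OF mero] by blast
  obtain N C d where N: "d > 0" "C \<ge> 0"
    "\<And>w. w \<noteq> 0 \<Longrightarrow> cmod w < d \<Longrightarrow> cmod (H w) * cmod w ^ N \<le> C"
    using meromorphic_growth[OF H(1)] by metis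
  obtain M' K where K: "K \<ge> 0" "\<And>x y. y\<^sup>2 = poly f x \<Longrightarrow> M' \<le> cmod x \<Longrightarrow>
       x ^ g / y \<noteq> 0 \<and> cmod (x ^ g / y) < d \<and> cmod (x ^ g / y) \<le> 1 \<and>
       1 \<le> K * cmod x * cmod (x ^ g / y) ^ 2"
    using infinity_coordinate_estimate[OF N(1)] by metis
  have bound: "cmod (h (Some (x, y))) \<le> C * K ^ N * cmod x ^ N"
    if xy: "y\<^sup>2 = poly f x" and big: "max M' (M + 1) \<le> cmod x" for x y
  proof -
    let ?w = "x ^ g / y"
    have w: "?w \<noteq> 0" "cmod ?w < d" "cmod ?w \<le> 1" "1 \<le> K * cmod x * cmod ?w ^ 2"
      using K(2)[OF xy] big by auto
    have h: "h (Some (x, y)) = H ?w" using H(2)[OF xy] big by auto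
    have "1 \<le> (K * cmod x * cmod ?w ^ 2) ^ N" using w(4) by (rule one_le_power)
    also have "\<dots> = K ^ N * cmod x ^ N * (cmod ?w ^ N * cmod ?w ^ N)"
      by (simp add: power_mult_distrib power2_eq_square)
    also have "\<dots> \<le> K ^ N * cmod x ^ N * (cmod ?w ^ N * 1)"
      using K(1) w(3) by (intro mult_left_mono power_le_one) auto
    finally have "1 \<le> K ^ N * cmod x ^ N * cmod ?w ^ N" by simp
    then have "cmod (H ?w) * 1 \<le> cmod (H ?w) * (K ^ N * cmod x ^ N * cmod ?w ^ N)"
      by (rule mult_left_mono) simp
    also have "\<dots> = (cmod (H ?w) * cmod ?w ^ N) * (K ^ N * cmod x ^ N)" by simp
    also have "\<dots> \<le> C * (K ^ N * cmod x ^ N)"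
      using N(3)[OF w(1,2)] K(1) by (intro mult_right_mono) auto
    finally show ?thesis by (simp add: h mult.assoc)
  qed
  have "cmod (\<tau> x) \<le> (2 * C * K ^ N) * cmod x ^ N" if "max M' (M + 1) \<le> cmod x" for x
  proof -
    let ?y = "csqrt (poly f x)"
    have "cmod (\<tau> x) \<le> cmod (h (Some (x, ?y))) + cmod (h (Some (x, - ?y)))"
      unfolding \<tau>_def by (rule norm_triangle_ineq)
    also have "\<dots> \<le> C * K ^ N * cmod x ^ N + C * K ^ N * cmod x ^ N"
      using that by (intro add_mono bound) auto
    finally show ?thesis by simp
  qed
  then obtain T where "\<And>x. \<tau> x = poly T x"
    using entire_polynomial_growth[OF entire] by metis
  then show ?thesis using that trace by metis
qed

text \<open>The traces of \<open>h\<close> and of \<open>h y\<close> determine the even and the odd part of \<open>h\<close>. The trace of \<open>h y\<close>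
  vanishes at the roots of \<open>f\<close>, so it is divisible by \<open>f = y\<^sup>2\<close> and the odd part is a polynomial
  multiple of \<open>y\<close>.\<close>

lemma meromorphic_function_decomposition:
  assumes zero: "\<And>P. P \<notin> Some ` affine_curve f \<Longrightarrow> h P = 0"
    and hol: "\<And>p. p \<in> affine_curve f \<Longrightarrow> holomorphic_at f h (Some p)"
    and mero: "meromorphic_at f h None"
  obtains A B where "h = curve_function A B"
proof -
  obtain T\<^sub>1 where T\<^sub>1: "\<And>x y. y\<^sup>2 = poly f x \<Longrightarrow> h (Some (x, y)) + h (Some (x, - y)) = poly T\<^sub>1 x"
    using trace_polynomial[OF hol mero] by metis
  \<comment> \<open>multiplication by \<open>y\<close> exchanges even and odd parts\<close>
  define hy where "hy = (\<lambda>P. h P * ycoord P)"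
  have "holomorphic_at f hy (Some p)" if p: "p \<in> affine_curve f" for p
  proof -
    obtain a b where [simp]: "p = (a, b)" by (cases p)
    have "(a, b) \<in> affine_curve f" using p by (simp only: \<open>p = (a, b)\<close>)
    note y = affine_parametrisation(3)[OF this]
    have "(\<lambda>z. h (parametrisation_at f (Some p) z)) analytic_on {0}"
      using hol[OF p] by (simp add: holomorphic_at_def o_def)
    then show ?thesis
      using y unfolding holomorphic_at_def hy_def o_def by (intro analytic_intros) auto
  qed
  moreover have "meromorphic_at f hy None"
    using mero has_orderD(1)[OF has_order_x_infinity(2)]
    unfolding meromorphic_at_def hy_def o_def by (rule meromorphic_on_mult)
  ultimately obtain T\<^sub>2 where
    T\<^sub>2: "\<And>x y. y\<^sup>2 = poly f x \<Longrightarrow> hy (Some (x, y)) + hy (Some (x, - y)) = poly T\<^sub>2 x"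
    using trace_polynomial[of hy] by metis
  have "poly T\<^sub>2 a = 0" if "poly f a = 0" for a
    using T\<^sub>2[of 0 a] that by (simp add: hy_def ycoord_def)
  then have "f dvd T\<^sub>2" by (rule dvd_of_vanishing_at_roots)
  then obtain B where B: "T\<^sub>2 = f * B" by (rule dvdE)
  show ?thesis
  proof (rule that, rule ext)
    fix P
    show "h P = curve_function (smult (1/2) T\<^sub>1) (smult (1/2) B) P"
    proof (cases "P \<in> Some ` affine_curve f")
      case False
      then show ?thesis using zero by (auto simp: curve_function_def split: option.splits)
    next
      case True
      then obtain x y where P: "P = Some (x, y)" and xy: "y\<^sup>2 = poly f x" by auto
      let ?d = "h (Some (x, y)) - h (Some (x, - y))"
      have "?d = poly B x * y"
      proof (cases "y = 0")
        case False
        have "y * ?d = poly T\<^sub>2 x"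
          using T\<^sub>2[OF xy] by (simp add: hy_def ycoord_def algebra_simps)
        also have "\<dots> = y * (poly B x * y)"
          by (simp add: B xy[symmetric] power2_eq_square)
        finally show ?thesis using False by simp
      qed simp
      moreover have "h P + h P = (h (Some (x, y)) + h (Some (x, - y))) + ?d" by (simp add: P)
      ultimately have "h P + h P = poly T\<^sub>1 x + poly B x * y"
        using T\<^sub>1[OF xy] by simp
      then have "2 * h P = poly T\<^sub>1 x + poly B x * y" by (simp only: mult_2)
      then have "h P = poly T\<^sub>1 x / 2 + poly B x * y / 2" by (simp add: field_simps)
      then show ?thesis using xy by (simp add: curve_function_def P)
    qed
  qed
qed

end

section \<open>The weight of the gap sequence\<close>

lemma sum_fun_apply: "(\<Sum>i\<in>I. u i) P = (\<Sum>i\<in>I. u i P)"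
  for u :: "'i \<Rightarrow> 'a \<Rightarrow> 'b::comm_monoid_add"
  by (induction I rule: infinite_finite_induct) auto

lemma coeff_sum_monom:
  assumes "finite S"
  shows "coeff (\<Sum>i\<in>S. monom (c i) i) n = (if n \<in> S then c n else 0)"
  using assms by (simp add: coeff_sum)

lemma sum_sorted_list_of_set_minus_index:
  fixes S :: "int set"
  assumes "finite S" "card S = n"
  shows "2 * (\<Sum>i<n. sorted_list_of_set S ! i - int i) = 2 * \<Sum>S - int n * (int n - 1)"
proof -
  have "(\<Sum>i<n. sorted_list_of_set S ! i) = sum_list (sorted_list_of_set S)"
    using assms by (simp add: sum_list_sum_nth atLeast0LessThan)
  also have "\<dots> = \<Sum>S"
    using assms(1) by (simp add: distinct_sum_list_conv_Sum)
  finally have 1: "(\<Sum>i<n. sorted_list_of_set S ! i) = \<Sum>S" .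
  have 2: "2 * (\<Sum>i<n. int i) = int n * (int n - 1)"
    by (induction n) (auto simp: algebra_simps)
  show ?thesis
    by (simp only: sum_subtractf 1 right_diff_distrib 2)
qed

text \<open>The even numbers up to \<open>2 (m + g)\<close> and the odd numbers below \<open>2 m\<close>: up to \<open>2 m\<close> nothing is
  missing, after that every odd number is, and the weights of the last \<open>g\<close> terms are \<open>1, \<dots>, g\<close>.\<close>

lemma gap_weight:
  fixes g m :: nat
  defines "S \<equiv> (\<lambda>i. 2 * int i) ` {..m + g} \<union> (\<lambda>j. 2 * int j + 1) ` {..<m}"
  shows "finite S" "card S = 2 * m + g + 1"
    and "(\<Sum>i<2 * m + g + 1. sorted_list_of_set S ! i - int i) = int ((g + 1) choose 2)"
proof -
  show fin: "finite S" by (simp add: S_def)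
  have disj: "(\<lambda>i. 2 * int i) ` {..m + g} \<inter> (\<lambda>j. 2 * int j + 1) ` {..<m} = {}"
    by (auto, presburger)
  have inj: "inj_on (\<lambda>i. 2 * int i) {..m + g}" "inj_on (\<lambda>j. 2 * int j + 1) {..<m}"
    by (auto simp: inj_on_def)
  show card: "card S = 2 * m + g + 1"
    unfolding S_def using disj inj by (subst card_Un_disjoint) (auto simp: card_image)
  have even: "(\<Sum>i\<le>n. 2 * int i) = int n * (int n + 1)" for n
    by (induction n) (auto simp: algebra_simps)
  have odd: "(\<Sum>j<n. 2 * int j + 1) = int n * int n" for n
    by (induction n) (auto simp: algebra_simps)
  have "\<Sum>S = (\<Sum>i\<le>m + g. 2 * int i) + (\<Sum>j<m. 2 * int j + 1)"
    unfolding S_def using disj inj by (subst sum.union_disjoint) (auto simp: sum.reindex)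
  then have sum: "\<Sum>S = int (m + g) * (int (m + g) + 1) + int m * int m"
    by (simp only: even odd)
  have "2 * ((g + 1) choose 2) = (g + 1) * g" by (simp add: choose_two)
  then have "2 * int ((g + 1) choose 2) = (int g + 1) * int g"
    by (metis of_nat_1 of_nat_add of_nat_mult of_nat_numeral)
  then have "2 * (\<Sum>i<2 * m + g + 1. sorted_list_of_set S ! i - int i) = 2 * int ((g + 1) choose 2)"
    unfolding sum_sorted_list_of_set_minus_index[OF fin card] sum
    by (simp add: algebra_simps)
  then show "(\<Sum>i<2 * m + g + 1. sorted_list_of_set S ! i - int i) = int ((g + 1) choose 2)"
    by simp
qed

section \<open>The space of sections\<close>

context odd_hyperelliptic
begin

lemma curve_function_add:
  "curve_function A B P + curve_function A' B' P = curve_function (A + A') (B + B') P"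
  by (auto simp: curve_function_def algebra_simps split: option.splits)

lemma curve_function_smult:
  "c * curve_function A B P = curve_function (smult c A) (smult c B) P"
  by (auto simp: curve_function_def algebra_simps split: option.splits)

lemma curve_function_zero [simp]: "curve_function 0 0 = (\<lambda>_. 0)"
  by (auto simp: curve_function_def fun_eq_iff split: option.splits)

lemma curve_function_eq_zero:
  assumes "curve_function A B = (\<lambda>_. 0)"
  shows "A = 0" "B = 0"
proof -
  have eq: "poly A x + poly B x * y = 0" if "y\<^sup>2 = poly f x" for x y
    using fun_cong[OF assms, of "Some (x, y)"] that by (simp add: curve_function_def)
  have "poly A x = 0 \<and> poly (B * f) x = 0" for x
  proof -
    let ?y = "csqrt (poly f x)"
    have "poly A x + poly B x * ?y = 0" "poly A x + poly B x * - ?y = 0"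
      by (rule eq; simp)+
    then have "2 * poly A x = 0" "2 * (poly B x * ?y) = 0"
      by (simp_all add: eq_neg_iff_add_eq_0 algebra_simps)
    then have "poly A x = 0" "poly B x * ?y = 0" by simp_all
    moreover from this have "poly B x * ?y ^ 2 = 0" by auto
    ultimately show ?thesis by simp
  qed
  then have "A = 0" "B * f = 0" by (simp_all only: poly_all_0_iff_0[symmetric]) auto
  then show "A = 0" "B = 0" using f_nonzero by auto
qed

lemma curve_function_inject:
  assumes "curve_function A B = curve_function A' B'"
  shows "A = A'" "B = B'"
proof -
  have "curve_function (A - A') (B - B') P = curve_function A B P - curve_function A' B' P" for P
    by (auto simp: curve_function_def algebra_simps split: option.splits)
  then have "curve_function (A - A') (B - B') = (\<lambda>_. 0)"
    using assms by auto
  from curve_function_eq_zero[OF this] show "A = A'" "B = B'" by simp_all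
qed

text \<open>The degrees of \<open>A\<^sup>2\<close> and \<open>f B\<^sup>2\<close> have different parity.\<close>

lemma norm_polynomial_nonzero:
  assumes "A \<noteq> 0 \<or> B \<noteq> 0"
  shows "A * A - f * (B * B) \<noteq> 0"
proof
  assume "A * A - f * (B * B) = 0"
  then have eq: "A * A = f * (B * B)" by simp
  then have "A \<noteq> 0" "B \<noteq> 0" using assms f_nonzero by auto
  then have "degree A + degree A = 2 * g + 1 + (degree B + degree B)"
    using arg_cong[OF eq, of degree] f_nonzero by (simp add: degree_mult_eq degree_f)
  then show False by presburger
qed

text \<open>The product of \<open>A(x) + B(x) y\<close> with its conjugate \<open>A(x) - B(x) y\<close> is a non-zero polynomial in
  \<open>x\<close>, whose zeros are isolated.\<close>

lemma curve_function_nonvanishing: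
  assumes "(a, b) \<in> affine_curve f" "A \<noteq> 0 \<or> B \<noteq> 0"
  shows "\<forall>\<^sub>F z in at 0. curve_function A B (parametrisation_at f (Some (a, b)) z) \<noteq> 0"
proof -
  define \<gamma> where "\<gamma> = parametrisation_at f (Some (a, b))"
  note \<gamma> = affine_parametrisation[OF assms(1), folded \<gamma>_def]
  obtain m where "has_order (\<lambda>z. xcoord (\<gamma> z) - a) m"
    using has_order_x_branch_point[of a] regular_point_parametrisation(2)[of b a] assms(1)
    unfolding \<gamma>_def by (cases "b = 0") auto
  then have "has_order (\<lambda>z. poly (A * A - f * (B * B)) (xcoord (\<gamma> z)))
      (int (order a (A * A - f * (B * B))) * m)"
    using \<gamma>(1) by (intro has_order_poly \<gamma>(2) norm_polynomial_nonzero assms(2)) (simp add: xcoord_def)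
  note nz = has_orderD(2)[OF this]
  have "\<forall>\<^sub>F z in at 0. \<gamma> z \<in> Some ` affine_curve f"
    by (rule filter_leD[OF at_within_le_nhds \<gamma>(4)])
  with nz have "\<forall>\<^sub>F z in at 0. curve_function A B (\<gamma> z) \<noteq> 0"
  proof eventually_elim
    case (elim z)
    then obtain x y where xy: "\<gamma> z = Some (x, y)" "y\<^sup>2 = poly f x" by auto
    have "(poly A x + poly B x * y) * (poly A x - poly B x * y)
        = poly A x * poly A x - y\<^sup>2 * (poly B x * poly B x)"
      by (simp add: power2_eq_square algebra_simps)
    also have "\<dots> \<noteq> 0" using elim(1) by (simp add: xy xcoord_def)
    finally show ?case by (auto simp: xy curve_function_def)
  qed
  then show ?thesis by (simp add: \<gamma>_def)
qed

text \<open>A function \<open>A(x) + B(x) y\<close> has a pole of order at most \<open>2 k\<close> at infinity iff its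
  coefficients lie in this set (for \<open>k \<ge> g\<close>, so that the subtraction is exact). Bounding
  coefficients instead of degrees makes \<open>B = 0\<close> no exception and the set visibly linear.\<close>

definition section_coeffs :: "nat \<Rightarrow> (complex poly \<times> complex poly) set" where
  "section_coeffs k = {(A, B). (\<forall>i>k. coeff A i = 0) \<and> (\<forall>j\<ge>k - g. coeff B j = 0)}"

lemma section_coeffs_degree:
  assumes "g \<le> k"
  shows "(A, B) \<in> section_coeffs k \<longleftrightarrow> degree A \<le> k \<and> (B = 0 \<or> degree B + g + 1 \<le> k)"
proof -
  have "(\<forall>i>k. coeff A i = 0) \<longleftrightarrow> degree A \<le> k"
    using coeff_eq_0[of A] degree_le[of k A] by fastforce
  moreover have "(\<forall>j\<ge>k - g. coeff B j = 0) \<longleftrightarrow> B = 0 \<or> degree B + g + 1 \<le> k"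
  proof (cases "B = 0")
    case False
    then have "degree B < k - g" if "\<forall>j\<ge>k - g. coeff B j = 0"
      using that leading_coeff_neq_0[OF False] by (meson not_le)
    moreover have "\<forall>j\<ge>k - g. coeff B j = 0" if "degree B < k - g"
      using that by (auto intro!: coeff_eq_0)
    moreover have "degree B < k - g \<longleftrightarrow> degree B + g + 1 \<le> k" using assms by linarith
    ultimately show ?thesis using False by blast
  qed simp
  ultimately show ?thesis by (simp add: section_coeffs_def)
qed

abbreviation kD :: "nat \<Rightarrow> divisor" where
  "kD k \<equiv> \<lambda>P. int k * twice_infinity P"

lemma kD_simps: "kD k None = 2 * int k" "kD k (Some p) = 0"
  by (simp_all add: twice_infinity_def)

lemma section_order_infinity:
  assumes "A \<noteq> 0 \<or> B \<noteq> 0"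
  shows "section_order f (kD k) (curve_function A B) None =
    (if B = 0 then 2 * (int k - int (degree A))
     else if A = 0 then 2 * (int k - int (degree B + g) - 1) + 1
     else min (2 * (int k - int (degree A))) (2 * (int k - int (degree B + g) - 1) + 1))"
  using has_orderD(4)[OF curve_function_order_infinity[OF assms]]
  unfolding section_order_def ord_at_def o_def kD_simps by auto

lemma section_order_branch_point:
  assumes "poly f a = 0" "A \<noteq> 0 \<or> B \<noteq> 0"
  shows "section_order f (kD k) (curve_function A B) (Some (a, 0)) =
    (if B = 0 then 2 * int (order a A) else if A = 0 then 2 * int (order a B) + 1
     else min (2 * int (order a A)) (2 * int (order a B) + 1))"
  using has_orderD(4)[OF curve_function_order_branch_point[OF assms]]
  unfolding section_order_def ord_at_def o_def kD_simps by auto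

lemma curve_function_holomorphic:
  assumes "(a, b) \<in> affine_curve f"
  shows "holomorphic_at f (curve_function A B) (Some (a, b))"
proof -
  define \<gamma> where "\<gamma> = parametrisation_at f (Some (a, b))"
  note \<gamma> = affine_parametrisation[OF assms, folded \<gamma>_def]
  have "(\<lambda>z. poly A (xcoord (\<gamma> z)) + poly B (xcoord (\<gamma> z)) * ycoord (\<gamma> z)) analytic_on {0}"
    by (intro analytic_intros analytic_on_poly_compose \<gamma>(2,3))
  moreover have "\<forall>\<^sub>F z in nhds 0. curve_function A B (\<gamma> z)
      = poly A (xcoord (\<gamma> z)) + poly B (xcoord (\<gamma> z)) * ycoord (\<gamma> z)"
    using \<gamma>(4) by eventually_elim (rule curve_function_on_curve)
  ultimately show ?thesis
    unfolding holomorphic_at_def o_def \<gamma>_def[symmetric]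
    using analytic_at_cong[of "\<lambda>z. curve_function A B (\<gamma> z)" _ 0 0] by simp
qed

text \<open>The bounds on the degrees are exactly the condition on the order at infinity: by the parity of
  orders no pole of \<open>A(x)\<close> can cancel against one of \<open>B(x) y\<close>.\<close>

lemma global_sections_eq:
  assumes "g \<le> k" "k \<ge> 1"
  shows "global_sections f (kD k) = {curve_function A B | A B. (A, B) \<in> section_coeffs k}"
proof (intro equalityI subsetI)
  fix h assume h: "h \<in> global_sections f (kD k)"
  have "h P = 0" if "P \<notin> Some ` affine_curve f" for P
    using h that assms(2) by (cases P) (auto simp: global_sections_def twice_infinity_def)
  moreover have "holomorphic_at f h (Some p)" if "p \<in> affine_curve f" for p
    using h that by (auto simp: global_sections_def twice_infinity_def)
  moreover have "meromorphic_at f h None"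
    using h assms(2) by (auto simp: global_sections_def twice_infinity_def)
  ultimately obtain A B where AB: "h = curve_function A B"
    using meromorphic_function_decomposition by metis
  show "h \<in> {curve_function A B | A B. (A, B) \<in> section_coeffs k}"
  proof (cases "A = 0 \<and> B = 0")
    case True
    then show ?thesis unfolding AB by (auto simp: section_coeffs_def intro!: exI[of _ 0])
  next
    case False
    then have "h \<noteq> (\<lambda>_. 0)" using curve_function_eq_zero[of A B] unfolding AB by blast
    then have "section_order f (kD k) h None \<ge> 0"
      using h unfolding global_sections_def by simp
    then have "degree A \<le> k \<and> (B = 0 \<or> degree B + g + 1 \<le> k)"
      using False section_order_infinity[of A B k] unfolding AB by (auto split: if_splits)
    then show ?thesis using section_coeffs_degree[OF assms(1)] AB by blast
  qed
next
  fix h assume "h \<in> {curve_function A B | A B. (A, B) \<in> section_coeffs k}"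
  then obtain A B where h: "h = curve_function A B" and AB: "(A, B) \<in> section_coeffs k" by blast
  have deg: "degree A \<le> k" "B = 0 \<or> degree B + g + 1 \<le> k"
    using AB section_coeffs_degree[OF assms(1)] by auto
  have "h P = 0" if "P \<notin> topspace (curve f) \<or> kD k P \<noteq> 0" for P
    using that by (cases P) (auto simp: h curve_function_def twice_infinity_def)
  moreover have "holomorphic_at f h P" if "P \<in> topspace (curve f)" "kD k P = 0" for P
    using that assms(2) curve_function_holomorphic
    by (cases P) (auto simp: h twice_infinity_def)
  moreover have "meromorphic_at f h P" if "P \<in> topspace (curve f)" "kD k P \<noteq> 0" for P
  proof -
    have P: "P = None" using that(2) by (auto simp: twice_infinity_def split: if_splits)
    show ?thesis
    proof (cases "A = 0 \<and> B = 0")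
      case True
      then show ?thesis by (simp add: h meromorphic_at_def o_def meromorphic_on_const)
    next
      case False
      then show ?thesis
        using has_orderD(1)[OF curve_function_order_infinity, of A B]
        by (simp add: h P meromorphic_at_def o_def)
    qed
  qed
  moreover have "section_order f (kD k) h P \<ge> 0"
    if h_nz: "h \<noteq> (\<lambda>_. 0)" and P_mem: "P \<in> topspace (curve f)" for P
  proof -
    have nz: "A \<noteq> 0 \<or> B \<noteq> 0" using h_nz by (auto simp: h)
    show ?thesis
    proof (cases P)
      case None
      then show ?thesis using section_order_infinity[OF nz, of k] deg nz
        by (auto simp: h)
    next
      case (Some p)
      then obtain a b where ab: "P = Some (a, b)" "(a, b) \<in> affine_curve f"
        using P_mem by auto
      have "zorder (\<lambda>z. h (parametrisation_at f P z)) 0 \<ge> 0"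
      proof (rule zorder_ge_0)
        show "(\<lambda>z. h (parametrisation_at f P z)) analytic_on {0}"
          using curve_function_holomorphic[OF ab(2), of A B]
          by (simp add: holomorphic_at_def h ab(1) o_def)
        show "\<exists>\<^sub>F z in at 0. h (parametrisation_at f P z) \<noteq> 0"
          unfolding h ab(1)
          by (intro eventually_frequently curve_function_nonvanishing[OF ab(2) nz]) simp
      qed
      then show ?thesis by (simp add: section_order_def ord_at_def ab(1) o_def kD_simps)
    qed
  qed
  ultimately show "h \<in> global_sections f (kD k)"
    unfolding global_sections_def by blast
qed

end

section \<open>The real linear series\<close>

locale real_odd_hyperelliptic = odd_hyperelliptic +
  assumes real_f: "\<And>x. poly f (cnj x) = cnj (poly f x)"
begin

definition real_coeffs :: "complex poly \<Rightarrow> bool" where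
  "real_coeffs A \<longleftrightarrow> (\<forall>i. coeff A i \<in> \<real>)"

text \<open>Conjugation maps \<open>A(x) + B(x) y\<close> to the function with conjugated coefficients, and \<open>A\<close> and \<open>B\<close>
  are determined by the function.\<close>

lemma real_sections_eq:
  assumes "g \<le> k" "k \<ge> 1"
  shows "real_sections f (kD k) =
    {curve_function A B | A B. (A, B) \<in> section_coeffs k \<and> real_coeffs A \<and> real_coeffs B}"
proof (intro equalityI subsetI)
  fix h assume "h \<in> real_sections f (kD k)"
  then have glob: "h \<in> global_sections f (kD k)"
    and real: "\<And>P. P \<in> topspace (curve f) \<Longrightarrow> h (conj_point P) = cnj (h P)"
    by (auto simp: real_sections_def)
  obtain A B where h: "h = curve_function A B" and AB: "(A, B) \<in> section_coeffs k"
    using glob global_sections_eq[OF assms] by auto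
  have "curve_function (map_poly cnj A) (map_poly cnj B) P = curve_function A B P" for P
  proof (cases "P \<in> Some ` affine_curve f")
    case False
    then show ?thesis by (auto simp: curve_function_def split: option.splits)
  next
    case True
    then obtain x y where P: "P = Some (x, y)" and xy: "y\<^sup>2 = poly f x" by auto
    have xy': "(cnj y)\<^sup>2 = poly f (cnj x)" by (simp add: real_f flip: xy)
    have "h (conj_point P) = cnj (h P)" using real True by auto
    then have "poly A (cnj x) + poly B (cnj x) * cnj y = cnj (poly A x + poly B x * y)"
      using xy xy' by (simp add: h P conj_point_def curve_function_def)
    then have "cnj (poly A (cnj x)) + cnj (poly B (cnj x)) * y = poly A x + poly B x * y"
      by (metis complex_cnj_add complex_cnj_cnj complex_cnj_mult)
    then show ?thesis using xy by (simp add: P curve_function_def)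
  qed
  then have "curve_function (map_poly cnj A) (map_poly cnj B) = curve_function A B" by (rule ext)
  from curve_function_inject[OF this]
  have "cnj (coeff A i) = coeff A i" "cnj (coeff B i) = coeff B i" for i
    by (metis coeff_map_poly complex_cnj_zero)+
  then have "real_coeffs A" "real_coeffs B"
    by (auto simp: real_coeffs_def Reals_cnj_iff)
  then show "h \<in> {curve_function A B | A B. (A, B) \<in> section_coeffs k \<and> real_coeffs A \<and> real_coeffs B}"
    using h AB by blast
next
  fix h assume "h \<in> {curve_function A B | A B. (A, B) \<in> section_coeffs k \<and> real_coeffs A \<and> real_coeffs B}"
  then obtain A B where h: "h = curve_function A B" and AB: "(A, B) \<in> section_coeffs k"
    and real: "real_coeffs A" "real_coeffs B" by blast
  have cnj: "cnj (poly A x) = poly A (cnj x)" "cnj (poly B x) = poly B (cnj x)" for x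
    using real by (auto simp: real_coeffs_def intro!: poly_cnj_real)
  have "h (conj_point P) = cnj (h P)" if P_mem: "P \<in> topspace (curve f)" for P
  proof (cases P)
    case None
    then show ?thesis by (simp add: h conj_point_def curve_function_def)
  next
    case (Some p)
    then obtain x y where P: "P = Some (x, y)" and xy: "y\<^sup>2 = poly f x" using P_mem by auto
    have xy': "(cnj y)\<^sup>2 = poly f (cnj x)" by (simp add: real_f flip: xy)
    then show ?thesis using xy by (simp add: h P conj_point_def curve_function_def cnj)
  qed
  moreover have "h \<in> global_sections f (kD k)"
    using h AB global_sections_eq[OF assms] by auto
  ultimately show "h \<in> real_sections f (kD k)" by (simp add: real_sections_def)
qed

lemma complexification_real_sections:
  assumes "g \<le> k" "k \<ge> 1"
  shows "complexification (real_sections f (kD k)) =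
    {curve_function A B | A B. (A, B) \<in> section_coeffs k}"
proof (intro equalityI subsetI)
  fix h assume "h \<in> complexification (real_sections f (kD k))"
  then obtain s t where st: "s \<in> real_sections f (kD k)" "t \<in> real_sections f (kD k)"
    and h: "h = (\<lambda>P. s P + \<i> * t P)" by (auto simp: complexification_def)
  obtain A B A' B' where s: "s = curve_function A B" "(A, B) \<in> section_coeffs k"
    and t: "t = curve_function A' B'" "(A', B') \<in> section_coeffs k"
    using st unfolding real_sections_eq[OF assms] by blast
  have "h = curve_function (A + smult \<i> A') (B + smult \<i> B')"
    by (simp add: h s(1) t(1) curve_function_smult curve_function_add)
  moreover have "(A + smult \<i> A', B + smult \<i> B') \<in> section_coeffs k"
    using s(2) t(2) by (auto simp: section_coeffs_def)
  ultimately show "h \<in> {curve_function A B | A B. (A, B) \<in> section_coeffs k}" by blast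
next
  fix h assume "h \<in> {curve_function A B | A B. (A, B) \<in> section_coeffs k}"
  then obtain A B where h: "h = curve_function A B" and AB: "(A, B) \<in> section_coeffs k" by blast
  define re where "re = map_poly (\<lambda>c. complex_of_real (Re c))"
  define im where "im = map_poly (\<lambda>c. complex_of_real (Im c))"
  have coeffs: "coeff (re A) i = Re (coeff A i)" "coeff (im A) i = Im (coeff A i)" for A i
    by (simp_all add: re_def im_def coeff_map_poly)
  have split: "A = re A + smult \<i> (im A)" for A
    by (intro poly_eqI) (simp add: coeffs flip: complex_eq)
  have mem: "(re A, re B) \<in> section_coeffs k" "(im A, im B) \<in> section_coeffs k"
    using AB by (auto simp: section_coeffs_def coeffs)
  have real: "real_coeffs (re A)" "real_coeffs (im A)" for A
    by (simp_all add: real_coeffs_def coeffs)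
  have "h = (\<lambda>P. curve_function (re A) (re B) P + \<i> * curve_function (im A) (im B) P)"
    unfolding curve_function_smult curve_function_add split[symmetric] h ..
  moreover have "curve_function (re A) (re B) \<in> real_sections f (kD k)"
    "curve_function (im A) (im B) \<in> real_sections f (kD k)"
    unfolding real_sections_eq[OF assms] using mem real by blast+
  ultimately show "h \<in> complexification (real_sections f (kD k))"
    unfolding complexification_def by blast
qed

text \<open>The monomials \<open>x^i\<close> and \<open>x^j y\<close> form a basis.\<close>

lemma real_dim_real_sections:
  assumes "g \<le> k" "k \<ge> 1"
  shows "real_dim (real_sections f (kD k)) = k + 1 + (k - g)"
proof -
  let ?scale = "\<lambda>(c::real) (h::point \<Rightarrow> complex) P. c *\<^sub>R h P"
  interpret vector_space ?scale
    by unfold_locales (auto simp: fun_eq_iff scaleR_right_distrib scaleR_left_distrib)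
  define e :: "nat + nat \<Rightarrow> point \<Rightarrow> complex" where
    "e = case_sum (\<lambda>i. curve_function (monom 1 i) 0) (\<lambda>j. curve_function 0 (monom 1 j))"
  define I where "I = {..k} <+> {..<k - g}"
  have fin: "finite I" by (simp add: I_def)
  have combination: "(\<Sum>x\<in>I. ?scale (c x) (e x)) =
      curve_function (\<Sum>i\<le>k. monom (of_real (c (Inl i))) i)
        (\<Sum>j<k - g. monom (of_real (c (Inr j))) j)" for c
  proof
    fix P
    show "(\<Sum>x\<in>I. ?scale (c x) (e x)) P = curve_function (\<Sum>i\<le>k. monom (of_real (c (Inl i))) i)
        (\<Sum>j<k - g. monom (of_real (c (Inr j))) j) P"
      unfolding sum_fun_apply I_def
      by (cases P) (auto simp: sum.Plus e_def curve_function_def poly_sum poly_monom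
          scaleR_conv_of_real sum_distrib_right mult.assoc)
  qed
  have inj: "inj_on e I"
  proof (rule inj_onI)
    fix x y assume "e x = e y"
    then show "x = y"
      by (cases x; cases y)
         (auto simp: e_def monom_eq_iff' dest: curve_function_inject)
  qed
  have indep: "independent (e ` I)"
  proof (rule independent_if_scalars_zero)
    fix c v assume sum: "(\<Sum>v\<in>e ` I. ?scale (c v) v) = 0" and "v \<in> e ` I"
    then obtain x where x: "x \<in> I" "v = e x" by blast
    have "(\<Sum>x\<in>I. ?scale (c (e x)) (e x)) = 0"
      using sum unfolding sum.reindex[OF inj] o_def .
    then have "curve_function (\<Sum>i\<le>k. monom (of_real (c (e (Inl i)))) i)
        (\<Sum>j<k - g. monom (of_real (c (e (Inr j)))) j) = (\<lambda>_. 0)"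
      unfolding combination by (simp add: fun_eq_iff)
    note zero = curve_function_eq_zero[OF this]
    show "c v = 0"
    proof (cases x)
      case (Inl i)
      then have "i \<le> k" using x(1) by (auto simp: I_def)
      then have "complex_of_real (c v) = 0"
        using arg_cong[OF zero(1), of "\<lambda>p. coeff p i"] x(2) Inl by (simp add: coeff_sum_monom)
      then show ?thesis by simp
    next
      case (Inr j)
      then have "j < k - g" using x(1) by (auto simp: I_def)
      then have "complex_of_real (c v) = 0"
        using arg_cong[OF zero(2), of "\<lambda>p. coeff p j"] x(2) Inr by (simp add: coeff_sum_monom)
      then show ?thesis by simp
    qed
  qed (simp add: fin)
  have "e ` I \<subseteq> real_sections f (kD k)"
  proof
    fix v assume "v \<in> e ` I"
    then obtain x where "x \<in> I" "v = e x" by blast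
    then show "v \<in> real_sections f (kD k)"
      unfolding real_sections_eq[OF assms] e_def I_def
      by (cases x) (fastforce simp: section_coeffs_def real_coeffs_def coeff_monom)+
  qed
  moreover have "real_sections f (kD k) \<subseteq> span (e ` I)"
  proof
    fix v assume "v \<in> real_sections f (kD k)"
    then obtain A B where v: "v = curve_function A B" and AB: "(A, B) \<in> section_coeffs k"
      and real: "real_coeffs A" "real_coeffs B"
      unfolding real_sections_eq[OF assms] by blast
    define c where "c = case_sum (\<lambda>i. Re (coeff A i)) (\<lambda>j. Re (coeff B j))"
    have "(\<Sum>i\<le>k. monom (of_real (c (Inl i))) i) = A"
      using AB real by (intro poly_eqI)
        (auto simp: coeff_sum_monom c_def section_coeffs_def real_coeffs_def)
    moreover have "(\<Sum>j<k - g. monom (of_real (c (Inr j))) j) = B"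
      using AB real by (intro poly_eqI)
        (auto simp: coeff_sum_monom c_def section_coeffs_def real_coeffs_def)
    ultimately have "v = (\<Sum>x\<in>I. ?scale (c x) (e x))" by (simp add: combination v)
    then show "v \<in> span (e ` I)"
      by (auto intro!: span_sum span_scale intro: span_base)
  qed
  moreover have "card (e ` I) = k + 1 + (k - g)"
    using card_image[OF inj] by (simp add: I_def card_Plus)
  ultimately show ?thesis
    unfolding real_dim_def using indep by (intro dim_unique)
qed

section \<open>Inflection at the ramification points\<close>

lemma vanishing_orders_eq:
  assumes "g \<le> k" "k \<ge> 1"
  shows "vanishing_orders f (kD k) (real_sections f (kD k)) P =
    {section_order f (kD k) (curve_function A B) P | A B.
       (A, B) \<in> section_coeffs k \<and> (A \<noteq> 0 \<or> B \<noteq> 0)}"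
  unfolding vanishing_orders_def complexification_real_sections[OF assms]
  using curve_function_eq_zero curve_function_zero by blast

lemma vanishing_orders_branch_point:
  assumes "g \<le> k" "k \<ge> 1" "poly f a = 0"
  shows "vanishing_orders f (kD k) (real_sections f (kD k)) (Some (a, 0)) =
    (\<lambda>i. 2 * int i) ` {..k} \<union> (\<lambda>j. 2 * int j + 1) ` {..<k - g}" (is "_ = ?E \<union> ?O")
proof (intro equalityI subsetI)
  fix v assume "v \<in> vanishing_orders f (kD k) (real_sections f (kD k)) (Some (a, 0))"
  then obtain A B where v: "v = section_order f (kD k) (curve_function A B) (Some (a, 0))"
    and AB: "(A, B) \<in> section_coeffs k" "A \<noteq> 0 \<or> B \<noteq> 0"
    unfolding vanishing_orders_eq[OF assms(1,2)] by blast
  have "2 * int (order a A) \<in> ?E" if "A \<noteq> 0"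
    using order_degree[OF that, of a] AB(1) section_coeffs_degree[OF assms(1), of A B] by auto
  moreover have "2 * int (order a B) + 1 \<in> ?O" if "B \<noteq> 0"
    using order_degree[OF that, of a] AB(1) that section_coeffs_degree[OF assms(1), of A B] by auto
  ultimately show "v \<in> ?E \<union> ?O"
    unfolding v section_order_branch_point[OF assms(3) AB(2)] using AB(2)
    by (auto simp: min_def)
next
  fix v assume "v \<in> ?E \<union> ?O"
  then show "v \<in> vanishing_orders f (kD k) (real_sections f (kD k)) (Some (a, 0))"
  proof
    assume "v \<in> ?E"
    then obtain i where i: "i \<le> k" "v = 2 * int i" by auto
    \<comment> \<open>the order \<open>2 i\<close> is attained by \<open>(x - a)^i\<close>\<close>
    let ?A = "[:- a, 1:] ^ i"
    have "(?A, 0) \<in> section_coeffs k"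
      using i(1) section_coeffs_degree[OF assms(1), of ?A 0] by (simp add: degree_power_eq)
    moreover have "v = section_order f (kD k) (curve_function ?A 0) (Some (a, 0))"
      by (subst section_order_branch_point[OF assms(3)]) (auto simp: order_power_n_n i(2))
    moreover have "?A \<noteq> 0" by simp
    ultimately show ?thesis unfolding vanishing_orders_eq[OF assms(1,2)] by blast
  next
    assume "v \<in> ?O"
    then obtain j where j: "j < k - g" "v = 2 * int j + 1" by auto
    \<comment> \<open>the order \<open>2 j + 1\<close> is attained by \<open>(x - a)^j y\<close>\<close>
    let ?B = "[:- a, 1:] ^ j"
    have "(0, ?B) \<in> section_coeffs k"
      using j(1) section_coeffs_degree[OF assms(1), of 0 ?B] by (simp add: degree_power_eq)
    moreover have "v = section_order f (kD k) (curve_function 0 ?B) (Some (a, 0))"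
      by (subst section_order_branch_point[OF assms(3)]) (auto simp: order_power_n_n j(2))
    moreover have "?B \<noteq> 0" by simp
    ultimately show ?thesis unfolding vanishing_orders_eq[OF assms(1,2)] by blast
  qed
qed

lemma vanishing_orders_infinity:
  assumes "g \<le> k" "k \<ge> 1"
  shows "vanishing_orders f (kD k) (real_sections f (kD k)) None =
    (\<lambda>i. 2 * int i) ` {..k} \<union> (\<lambda>j. 2 * int j + 1) ` {..<k - g}" (is "_ = ?E \<union> ?O")
proof (intro equalityI subsetI)
  fix v assume "v \<in> vanishing_orders f (kD k) (real_sections f (kD k)) None"
  then obtain A B where v: "v = section_order f (kD k) (curve_function A B) None"
    and AB: "(A, B) \<in> section_coeffs k" "A \<noteq> 0 \<or> B \<noteq> 0"
    unfolding vanishing_orders_eq[OF assms] by blast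
  have deg: "degree A \<le> k" "B \<noteq> 0 \<Longrightarrow> degree B + g + 1 \<le> k"
    using AB(1) section_coeffs_degree[OF assms(1), of A B] by auto
  have "2 * (int k - int (degree A)) \<in> ?E"
    using deg(1) by (intro image_eqI[of _ _ "k - degree A"]) auto
  moreover have "2 * (int k - int (degree B + g) - 1) + 1 \<in> ?O" if "B \<noteq> 0"
    using deg(2)[OF that] by (intro image_eqI[of _ _ "k - (degree B + g + 1)"]) auto
  ultimately show "v \<in> ?E \<union> ?O"
    unfolding v section_order_infinity[OF AB(2)] by (simp add: min_def)
next
  fix v assume "v \<in> ?E \<union> ?O"
  then show "v \<in> vanishing_orders f (kD k) (real_sections f (kD k)) None"
  proof
    assume "v \<in> ?E"
    then obtain i where i: "i \<le> k" "v = 2 * int i" by auto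
    \<comment> \<open>at infinity large orders come from small degrees\<close>
    let ?A = "monom 1 (k - i) :: complex poly"
    have "(?A, 0) \<in> section_coeffs k"
      using i(1) section_coeffs_degree[OF assms(1), of ?A 0] by (simp add: degree_monom_eq)
    moreover have "v = section_order f (kD k) (curve_function ?A 0) None"
      using i by (subst section_order_infinity) (auto simp: degree_monom_eq)
    moreover have "?A \<noteq> 0" by simp
    ultimately show ?thesis unfolding vanishing_orders_eq[OF assms] by blast
  next
    assume "v \<in> ?O"
    then obtain j where j: "j < k - g" "v = 2 * int j + 1" by auto
    let ?B = "monom 1 (k - g - 1 - j) :: complex poly"
    have "(0, ?B) \<in> section_coeffs k"
      using j(1) section_coeffs_degree[OF assms(1), of 0 ?B] by (simp add: degree_monom_eq)
    moreover have "v = section_order f (kD k) (curve_function 0 ?B) None"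
      using j by (subst section_order_infinity) (auto simp: degree_monom_eq)
    moreover have "?B \<noteq> 0" by simp
    ultimately show ?thesis unfolding vanishing_orders_eq[OF assms] by blast
  qed
qed

lemma ramification_locus_eq:
  "ramification_locus f = insert None {Some (a, 0) |a. poly f a = 0}"
proof -
  have "ramification_index f (Some (a, b)) = (if b = 0 then 2 else 1)" if "b\<^sup>2 = poly f a" for a b
    using that ramification_index_branch_point[of a] ramification_index_regular_point[of b a] by auto
  then show ?thesis
    by (auto simp: ramification_locus_def ramification_index_infinity split: if_splits)
qed

lemma ramification_divisor_eq:
  "ramification_divisor f P = (if P \<in> ramification_locus f then 1 else 0)"
proof -
  have "ramification_index f (Some (a, b)) = (if b = 0 then 2 else 1)" if "b\<^sup>2 = poly f a" for a b
    using that ramification_index_branch_point[of a] ramification_index_regular_point[of b a] by auto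
  then show ?thesis
    by (auto simp: ramification_divisor_def ramification_locus_def ramification_index_infinity
        split: if_splits)
qed

lemma inflection_at_ramification_point:
  assumes "g \<le> k" "k \<ge> 1" "P \<in> ramification_locus f"
  shows "complete_real_inflection f (kD k) P = int ((g + 1) choose 2)"
proof -
  let ?V = "real_sections f (kD k)"
  have "vanishing_orders f (kD k) ?V P =
      (\<lambda>i. 2 * int i) ` {..(k - g) + g} \<union> (\<lambda>j. 2 * int j + 1) ` {..<k - g}"
    using assms vanishing_orders_infinity[OF assms(1,2)] vanishing_orders_branch_point[OF assms(1,2)]
    by (auto simp: ramification_locus_eq)
  moreover have "real_dim ?V = 2 * (k - g) + g + 1"
    using real_dim_real_sections[OF assms(1,2)] assms(1) by simp
  moreover have "P \<in> topspace (curve f)" using assms(3) by (simp add: ramification_locus_def)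
  ultimately show ?thesis
    unfolding complete_real_inflection_def inflection_divisor_def inflectionary_weight_def
    by (simp only: gap_weight(3) if_True)
qed

end

section \<open>The inflection divisor over the ramification locus\<close>

lemma simple_roots_prod:
  fixes Z :: "'a::field set"
  assumes "finite Z" "poly (\<Prod>r\<in>Z. [:- r, 1:]) a = 0"
  shows "poly (pderiv (\<Prod>r\<in>Z. [:- r, 1:])) a \<noteq> 0"
proof -
  define h where "h = (\<Prod>r\<in>Z - {a}. [:- r, 1:])"
  have "a \<in> Z" using assms by (auto simp: poly_prod)
  then have prod: "(\<Prod>r\<in>Z. [:- r, 1:]) = [:- a, 1:] * h"
    unfolding h_def using assms(1) by (rule prod.remove[rotated])
  have "poly (pderiv ([:- a, 1:] * h)) a = poly h a"
    unfolding pderiv_mult by (simp add: pderiv_pCons)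
  moreover have "poly h a \<noteq> 0"
    using assms(1) by (auto simp: h_def poly_prod)
  ultimately show ?thesis unfolding prod by simp
qed

theorem theorem5p7:
  fixes g n k :: nat and p :: "nat \<Rightarrow> real" and q :: "nat \<Rightarrow> complex"
    and f :: "complex poly" and R S :: divisor
  assumes "g \<ge> 1"
    and "f = [:0, 1:] * (\<Prod>i = 1..2 * n - 2. [:- complex_of_real (p i), 1:])
               * (\<Prod>j = 1..g + 1 - n. [:- q j, 1:] * [:- cnj (q j), 1:])"
    and "n = num_real_components f" and "n \<ge> 1" and "n \<le> g + 1"
    and "\<And>i. i \<in> {1..2 * n - 2} \<Longrightarrow> p i \<noteq> 0"
    and "\<And>j. j \<in> {1..g + 1 - n} \<Longrightarrow> q j \<notin> \<real>"
    and "distinct ([0] @ map (\<lambda>i. complex_of_real (p i)) [1..<2 * n - 1]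
           @ map q [1..<g + 2 - n] @ map (\<lambda>j. cnj (q j)) [1..<g + 2 - n])"
    and "k \<ge> g"
    and "complete_real_inflection f (\<lambda>P. int k * twice_infinity P) = (\<lambda>P. R P + S P)"
    and "effective_divisor f R" and "effective_divisor f S"
    and "divisor_support R \<subseteq> ramification_locus f"
    and "divisor_support S \<inter> ramification_locus f = {}"
  shows "R = (\<lambda>P. int ((g + 1) choose 2) * ramification_divisor f P)"
proof -
  \<comment> \<open>\<open>f\<close> is the monic polynomial whose roots are the entries of a list without repetitions\<close>
  define L where "L = [0] @ map (\<lambda>i. complex_of_real (p i)) [1..<2 * n - 1]
           @ map q [1..<g + 2 - n] @ map (\<lambda>j. cnj (q j)) [1..<g + 2 - n]"
  have L: "distinct L" using assms(8) by (simp add: L_def)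
  have ivl: "{1..2 * n - 2} = set [1..<2 * n - 1]" "{1..g + 1 - n} = set [1..<g + 2 - n]"
    using assms(4,5) by auto
  have "f = prod_list (map (\<lambda>r. [:- r, 1:]) L)"
    unfolding assms(2) ivl prod.distrib
    by (simp add: L_def prod.distinct_set_conv_list o_def mult.assoc del: set_upt)
  also have "\<dots> = (\<Prod>r\<in>set L. [:- r, 1:])"
    using L by (simp add: prod.distinct_set_conv_list)
  finally have f: "f = (\<Prod>r\<in>set L. [:- r, 1:])" .
  have "degree f = card (set L)"
    unfolding f by (subst degree_prod_sum_eq) auto
  also have "\<dots> = 2 * g + 1"
    using distinct_card[OF L] assms(4,5) by (simp add: L_def)
  finally have deg: "degree f = 2 * g + 1" .
  interpret real_odd_hyperelliptic f g
  proof
    show "degree f = 2 * g + 1" by (rule deg)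
    show "poly (pderiv f) a \<noteq> 0" if "poly f a = 0" for a
      using simple_roots_prod[of "set L" a] that unfolding f by simp
    show "poly f (cnj x) = cnj (poly f x)" for x
      unfolding assms(2) by (simp add: poly_prod algebra_simps)
  qed
  show ?thesis
  proof
    fix P
    show "R P = int ((g + 1) choose 2) * ramification_divisor f P"
    proof (cases "P \<in> ramification_locus f")
      case True
      then have "S P = 0" using assms(14) by (auto simp: divisor_support_def)
      then have "R P = complete_real_inflection f (kD k) P" using assms(10) by simp
      also have "\<dots> = int ((g + 1) choose 2)"
        using assms(1,9) True by (intro inflection_at_ramification_point) auto
      finally show ?thesis using True by (simp add: ramification_divisor_eq)
    next
      case False
      then have "R P = 0" using assms(13) by (auto simp: divisor_support_def)
      then show ?thesis using False by (simp add: ramification_divisor_eq)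
    qed
  qed
qed

end
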